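(* Let $G$ be an infinite connected unipotent algebraic group over an algebraically closed field $\Bbbk$ of positive characteristic. Then $\delta(G)=\infty$.
   Context: A $G$-module is a finite-dimensional rational representation $V$ of the linear algebraic group $G$ over $\Bbbk$. $\Bbbk[V]\cong S(V^* )$ is the ring of polynomial functions on $V$, with $G$-action $(g\cdot f)(v)=f(g^{-1}v)$ and invariant ring $\Bbbk[V]^G$, graded by degree. $\Bbbk[V]^G_{\le d}$ is the set of invariants of degree at most $d$. For $S\subseteq \Bbbk[V]$, $S_+$ is the set of elements of $S$ with constant term zero. The nullcone $\mathcal{N}_{G,V}\subseteq V$ is the common zero set of $\Bbbk[V]^G_+$. A subset $S\subseteq\Bbbk[V]^G$ is a $\delta$-set if for every $v\in V^G\setminus\mathcal{N}_{G,V}$ there is $f\in S_+$ with $f(v)\neq 0$. Define $\delta(G,V)=\min\{d\ge 0 : \Bbbk[V]^G_{\le d}\text{ is a }\delta\text{-set}\}$ and $\delta(G)=\sup\{\delta(G,V): V\text{ a }G\text{-module}\}$ (equal to $\infty$ if unbounded). *)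

theory Defs
  imports
    "Jordan_Normal_Form.Determinant"
    "HOL-Algebra.Coset"
    "HOL-Library.Poly_Mapping"
    "HOL-Library.Extended_Nat"
    "HOL-Computational_Algebra.Polynomial"
    "HOL-Analysis.Abstract_Topology"
begin

section \<open>Polynomials in several variables\<close>

text \<open>The polynomial ring over \<open>'k\<close> in variables indexed by \<open>'i\<close>: finitely supported
  coefficient functions on finitely supported exponent vectors. Its ring structure (convolution)
  is the one of \<^theory>\<open>HOL-Library.Poly_Mapping\<close>.\<close>

type_synonym ('i, 'k) mpoly = "('i \<Rightarrow>\<^sub>0 nat) \<Rightarrow>\<^sub>0 'k"

definition monom_eval :: "('i \<Rightarrow>\<^sub>0 nat) \<Rightarrow> ('i \<Rightarrow> 'k) \<Rightarrow> 'k::comm_semiring_1" where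
  "monom_eval \<alpha> x = (\<Prod>i\<in>Poly_Mapping.keys \<alpha>. x i ^ Poly_Mapping.lookup \<alpha> i)"

definition mpoly_eval :: "('i, 'k) mpoly \<Rightarrow> ('i \<Rightarrow> 'k) \<Rightarrow> 'k::comm_semiring_1" where
  "mpoly_eval p x = (\<Sum>\<alpha>\<in>Poly_Mapping.keys p. Poly_Mapping.lookup p \<alpha> * monom_eval \<alpha> x)"

definition polys_in :: "'i set \<Rightarrow> ('i, 'k::zero) mpoly set" where
  "polys_in I = {p. \<forall>\<alpha>\<in>Poly_Mapping.keys p. Poly_Mapping.keys \<alpha> \<subseteq> I}"

definition total_degree :: "('i, 'k::zero) mpoly \<Rightarrow> nat" where
  "total_degree p = Max (insert 0
     ((\<lambda>\<alpha>. \<Sum>i\<in>Poly_Mapping.keys \<alpha>. Poly_Mapping.lookup \<alpha> i) ` Poly_Mapping.keys p))"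

lemma monom_eval_add: "monom_eval (\<alpha> + \<beta>) x = monom_eval \<alpha> x * monom_eval \<beta> x"
proof -
  let ?K = "Poly_Mapping.keys \<alpha> \<union> Poly_Mapping.keys \<beta>"
  have ext: "monom_eval \<gamma> x = (\<Prod>i\<in>?K. x i ^ Poly_Mapping.lookup \<gamma> i)"
    if "Poly_Mapping.keys \<gamma> \<subseteq> ?K" for \<gamma>
    unfolding monom_eval_def using that
    by (intro prod.mono_neutral_left) (auto simp: in_keys_iff)
  have "monom_eval (\<alpha> + \<beta>) x = (\<Prod>i\<in>?K. x i ^ Poly_Mapping.lookup (\<alpha> + \<beta>) i)"
    by (rule ext) (rule keys_add)
  also have "\<dots> = monom_eval \<alpha> x * monom_eval \<beta> x"
    by (simp add: ext lookup_add power_add prod.distrib)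
  finally show ?thesis .
qed

lemma mpoly_eval_superset:
  assumes "finite A" "Poly_Mapping.keys p \<subseteq> A"
  shows "mpoly_eval p x = (\<Sum>\<alpha>\<in>A. Poly_Mapping.lookup p \<alpha> * monom_eval \<alpha> x)"
  unfolding mpoly_eval_def using assms
  by (intro sum.mono_neutral_left) (auto simp: in_keys_iff)

lemma mpoly_eval_zero [simp]: "mpoly_eval 0 x = 0"
  by (simp add: mpoly_eval_def)

lemma mpoly_eval_one [simp]: "mpoly_eval 1 x = 1"
  by (simp add: mpoly_eval_def monom_eval_def)

lemma mpoly_eval_single [simp]: "mpoly_eval (Poly_Mapping.single \<alpha> c) x = c * monom_eval \<alpha> x"
  by (simp add: mpoly_eval_def)

lemma mpoly_eval_add: "mpoly_eval (p + q) x = mpoly_eval p x + mpoly_eval q x"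
proof -
  let ?K = "Poly_Mapping.keys p \<union> Poly_Mapping.keys q"
  have "mpoly_eval (p + q) x = (\<Sum>\<alpha>\<in>?K. Poly_Mapping.lookup (p + q) \<alpha> * monom_eval \<alpha> x)"
    by (rule mpoly_eval_superset) (auto dest: subsetD[OF keys_add])
  also have "\<dots> = mpoly_eval p x + mpoly_eval q x"
    by (simp add: mpoly_eval_superset[of ?K] lookup_add sum.distrib distrib_right)
  finally show ?thesis .
qed

lemma mpoly_eval_sum: "mpoly_eval (\<Sum>j\<in>J. p j) x = (\<Sum>j\<in>J. mpoly_eval (p j) x)"
  by (induction J rule: infinite_finite_induct) (simp_all add: mpoly_eval_add)

lemma mpoly_sum_singles:
  "(\<Sum>\<alpha>\<in>Poly_Mapping.keys p. Poly_Mapping.single \<alpha> (Poly_Mapping.lookup p \<alpha>)) = p"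
  by (rule poly_mapping_eqI) (auto simp: lookup_sum lookup_single when_def in_keys_iff)

lemma mpoly_eval_mult: "mpoly_eval (p * q) x = mpoly_eval p x * mpoly_eval q x"
proof -
  let ?s = "\<lambda>r \<alpha>. Poly_Mapping.single \<alpha> (Poly_Mapping.lookup r \<alpha>)"
  have "p * q = (\<Sum>\<alpha>\<in>Poly_Mapping.keys p. ?s p \<alpha>) * (\<Sum>\<beta>\<in>Poly_Mapping.keys q. ?s q \<beta>)"
    by (simp add: mpoly_sum_singles)
  also have "\<dots> = (\<Sum>\<alpha>\<in>Poly_Mapping.keys p. \<Sum>\<beta>\<in>Poly_Mapping.keys q.
      Poly_Mapping.single (\<alpha> + \<beta>) (Poly_Mapping.lookup p \<alpha> * Poly_Mapping.lookup q \<beta>))"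
    by (simp add: sum_product mult_single)
  finally show ?thesis
    by (simp add: mpoly_eval_sum monom_eval_add sum_product mult_ac)
       (simp add: mpoly_eval_def sum_product mult_ac)
qed

lemma polys_in_mult: "p \<in> polys_in I \<Longrightarrow> q \<in> polys_in I \<Longrightarrow> p * q \<in> polys_in I"
  unfolding polys_in_def
  by (auto dest!: subsetD[OF keys_mult] subsetD[OF keys_add])

lemma one_in_polys_in [simp]: "1 \<in> polys_in I"
  by (auto simp: polys_in_def)


section \<open>Linear algebraic groups\<close>

abbreviation GL :: "'k::field itself \<Rightarrow> nat \<Rightarrow> 'k mat monoid" where
  "GL ty n \<equiv> units_of (ring_mat ty n ())"

lemma group_GL: "group (GL TYPE('k::field) n)"
proof -
  interpret ring "ring_mat TYPE('k) n ()" by (rule ring_mat)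
  show ?thesis by (rule units_group)
qed

abbreviation mat_polys :: "nat \<Rightarrow> (nat \<times> nat, 'k::field) mpoly set" where
  "mat_polys n \<equiv> polys_in ({..<n} \<times> {..<n})"

abbreviation mat_eval :: "(nat \<times> nat, 'k) mpoly \<Rightarrow> 'k mat \<Rightarrow> 'k::field" where
  "mat_eval p g \<equiv> mpoly_eval p (\<lambda>ij. g $$ ij)"

definition GL_vanishing_set :: "nat \<Rightarrow> (nat \<times> nat, 'k) mpoly set \<Rightarrow> 'k::field mat set" where
  "GL_vanishing_set n P = {g \<in> carrier (GL TYPE('k) n). \<forall>p\<in>P. mat_eval p g = 0}"

definition zariski_GL :: "nat \<Rightarrow> 'k::field mat topology" where
  "zariski_GL n = topology
     (\<lambda>U. \<exists>P \<subseteq> mat_polys n. U = carrier (GL TYPE('k) n) - GL_vanishing_set n P)"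

lemma istopology_zariski_GL:
  "istopology (\<lambda>U. \<exists>P \<subseteq> mat_polys n. U = carrier (GL TYPE('k::field) n) - GL_vanishing_set n P)"
  unfolding istopology_def
proof (intro conjI allI impI)
  fix S T
  assume "\<exists>P \<subseteq> mat_polys n. S = carrier (GL TYPE('k) n) - GL_vanishing_set n P"
    and "\<exists>P \<subseteq> mat_polys n. T = carrier (GL TYPE('k) n) - GL_vanishing_set n P"
  then obtain P Q where PQ: "P \<subseteq> mat_polys n" "Q \<subseteq> mat_polys n"
    and S: "S = carrier (GL TYPE('k) n) - GL_vanishing_set n P"
    and T: "T = carrier (GL TYPE('k) n) - GL_vanishing_set n Q"
    by blast
  let ?R = "(\<lambda>(p, q). p * q) ` (P \<times> Q)"
  have "?R \<subseteq> mat_polys n"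
    using PQ by (auto intro!: polys_in_mult)
  moreover have "S \<inter> T = carrier (GL TYPE('k) n) - GL_vanishing_set n ?R"
    unfolding S T GL_vanishing_set_def by (auto simp: mpoly_eval_mult)
  ultimately show "\<exists>P \<subseteq> mat_polys n. S \<inter> T = carrier (GL TYPE('k) n) - GL_vanishing_set n P"
    by blast
next
  fix \<K> :: "'k mat set set"
  assume "\<forall>K\<in>\<K>. \<exists>P \<subseteq> mat_polys n. K = carrier (GL TYPE('k) n) - GL_vanishing_set n P"
  then obtain F where F: "\<And>K. K \<in> \<K> \<Longrightarrow> F K \<subseteq> mat_polys n"
    "\<And>K. K \<in> \<K> \<Longrightarrow> K = carrier (GL TYPE('k) n) - GL_vanishing_set n (F K)"
    by metis
  have "\<Union>\<K> = (\<Union>K\<in>\<K>. carrier (GL TYPE('k) n) - GL_vanishing_set n (F K))"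
    using F(2) by auto
  also have "\<dots> = carrier (GL TYPE('k) n) - GL_vanishing_set n (\<Union>K\<in>\<K>. F K)"
    unfolding GL_vanishing_set_def by blast
  finally show "\<exists>P \<subseteq> mat_polys n. \<Union>\<K> = carrier (GL TYPE('k) n) - GL_vanishing_set n P"
    using F(1) by (intro exI[of _ "\<Union>K\<in>\<K>. F K"]) auto
qed

lemma openin_zariski_GL:
  "openin (zariski_GL n) U \<longleftrightarrow>
     (\<exists>P \<subseteq> mat_polys n. U = carrier (GL TYPE('k::field) n) - GL_vanishing_set n P)"
  unfolding zariski_GL_def by (simp only: topology_inverse'[OF istopology_zariski_GL])

lemma topspace_zariski_GL: "topspace (zariski_GL n) = carrier (GL TYPE('k::field) n)"
proof
  show "topspace (zariski_GL n) \<subseteq> carrier (GL TYPE('k) n)"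
    unfolding topspace_def openin_zariski_GL by blast
  have "carrier (GL TYPE('k) n) = carrier (GL TYPE('k) n) - GL_vanishing_set n {1}"
    by (auto simp: GL_vanishing_set_def)
  then have "openin (zariski_GL n) (carrier (GL TYPE('k) n))"
    unfolding openin_zariski_GL by (intro exI[of _ "{1}"]) auto
  then show "carrier (GL TYPE('k) n) \<subseteq> topspace (zariski_GL n)"
    by (rule openin_subset)
qed

lemma closedin_zariski_GL:
  "closedin (zariski_GL n) (C :: 'k::field mat set) \<longleftrightarrow>
     (\<exists>P \<subseteq> mat_polys n. C = GL_vanishing_set n P)"
proof -
  let ?X = "carrier (GL TYPE('k) n)"
  have sub: "GL_vanishing_set n P \<subseteq> ?X" for P
    by (auto simp: GL_vanishing_set_def)
  have "C \<subseteq> ?X \<and> ?X - C = ?X - GL_vanishing_set n P \<longleftrightarrow> C = GL_vanishing_set n P" for P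
    using sub[of P] by blast
  then show ?thesis
    unfolding closedin_def topspace_zariski_GL openin_zariski_GL by blast
qed

definition linear_algebraic_group :: "nat \<Rightarrow> 'k::field mat set \<Rightarrow> bool" where
  "linear_algebraic_group n G \<longleftrightarrow>
     subgroup G (GL TYPE('k) n) \<and> closedin (zariski_GL n) G"

definition connected_group :: "nat \<Rightarrow> 'k::field mat set \<Rightarrow> bool" where
  "connected_group n G \<longleftrightarrow> connectedin (zariski_GL n) G"

definition unipotent_group :: "nat \<Rightarrow> 'k::field mat set \<Rightarrow> bool" where
  "unipotent_group n G \<longleftrightarrow> (\<forall>g\<in>G. \<exists>r. (g - 1\<^sub>m n) ^\<^sub>m r = 0\<^sub>m n n)"

text \<open>The coordinate ring of \<open>GL\<^sub>n\<close> is generated by the matrix entries and the inverse of the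
  determinant; the coordinate ring of a closed subgroup consists of the restrictions.\<close>

definition regular_functions :: "nat \<Rightarrow> 'k::field mat set \<Rightarrow> ('k mat \<Rightarrow> 'k) set" where
  "regular_functions n G =
     {f. \<exists>p\<in>mat_polys n. \<exists>r::nat. \<forall>g\<in>G. f g = mat_eval p g / det g ^ r}"


section \<open>Modules and invariants\<close>

text \<open>A module structure on \<open>V = k\<^sup>m\<close> (column vectors) is given by the homomorphism \<open>\<rho>\<close>
  from the group to \<open>GL\<^sub>m\<close>.\<close>

definition G_module :: "nat \<Rightarrow> 'k::field mat set \<Rightarrow> nat \<Rightarrow> ('k mat \<Rightarrow> 'k mat) \<Rightarrow> bool" where
  "G_module n G m \<rho> \<longleftrightarrow>
     \<rho> \<in> hom (GL TYPE('k) n\<lparr>carrier := G\<rparr>) (GL TYPE('k) m) \<and>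
     (\<forall>i<m. \<forall>j<m. (\<lambda>g. \<rho> g $$ (i, j)) \<in> regular_functions n G)"

definition poly_fun :: "nat \<Rightarrow> (nat, 'k) mpoly \<Rightarrow> 'k vec \<Rightarrow> 'k::field" where
  "poly_fun m p = restrict (\<lambda>v. mpoly_eval p (\<lambda>i. v $ i)) (carrier_vec m)"

definition coord_ring :: "nat \<Rightarrow> ('k vec \<Rightarrow> 'k::field) set" where
  "coord_ring m = poly_fun m ` polys_in {..<m}"

text \<open>Over an infinite field the polynomial representing a polynomial function is unique, so the
  following are the polynomial functions whose degree is at most \<open>d\<close>.\<close>

definition coord_ring_le :: "nat \<Rightarrow> nat \<Rightarrow> ('k vec \<Rightarrow> 'k::field) set" where
  "coord_ring_le m d = poly_fun m ` {p \<in> polys_in {..<m}. total_degree p \<le> d}"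

definition act_fun ::
  "nat \<Rightarrow> nat \<Rightarrow> ('k mat \<Rightarrow> 'k mat) \<Rightarrow> 'k mat \<Rightarrow> ('k vec \<Rightarrow> 'k) \<Rightarrow> 'k vec \<Rightarrow> 'k::field" where
  "act_fun n m \<rho> g f =
     restrict (\<lambda>v. f (\<rho> (inv\<^bsub>GL TYPE('k) n\<^esub> g) *\<^sub>v v)) (carrier_vec m)"

definition invariant_ring ::
  "nat \<Rightarrow> 'k::field mat set \<Rightarrow> nat \<Rightarrow> ('k mat \<Rightarrow> 'k mat) \<Rightarrow> ('k vec \<Rightarrow> 'k) set" where
  "invariant_ring n G m \<rho> = {f \<in> coord_ring m. \<forall>g\<in>G. act_fun n m \<rho> g f = f}"

definition invariant_ring_le ::
  "nat \<Rightarrow> 'k::field mat set \<Rightarrow> nat \<Rightarrow> ('k mat \<Rightarrow> 'k mat) \<Rightarrow> nat \<Rightarrow> ('k vec \<Rightarrow> 'k) set" where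
  "invariant_ring_le n G m \<rho> d = invariant_ring n G m \<rho> \<inter> coord_ring_le m d"

text \<open>The constant term of a polynomial function is its value at the origin.\<close>

definition plus_part :: "nat \<Rightarrow> ('k vec \<Rightarrow> 'k::field) set \<Rightarrow> ('k vec \<Rightarrow> 'k) set" where
  "plus_part m S = {f \<in> S. f (0\<^sub>v m) = 0}"

definition nullcone ::
  "nat \<Rightarrow> 'k::field mat set \<Rightarrow> nat \<Rightarrow> ('k mat \<Rightarrow> 'k mat) \<Rightarrow> 'k vec set" where
  "nullcone n G m \<rho> =
     {v \<in> carrier_vec m. \<forall>f \<in> plus_part m (invariant_ring n G m \<rho>). f v = 0}"

definition fixed_vectors :: "'k::field mat set \<Rightarrow> nat \<Rightarrow> ('k mat \<Rightarrow> 'k mat) \<Rightarrow> 'k vec set" where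
  "fixed_vectors G m \<rho> = {v \<in> carrier_vec m. \<forall>g\<in>G. \<rho> g *\<^sub>v v = v}"

definition delta_set ::
  "nat \<Rightarrow> 'k::field mat set \<Rightarrow> nat \<Rightarrow> ('k mat \<Rightarrow> 'k mat) \<Rightarrow> ('k vec \<Rightarrow> 'k) set \<Rightarrow> bool" where
  "delta_set n G m \<rho> S \<longleftrightarrow>
     S \<subseteq> invariant_ring n G m \<rho> \<and>
     (\<forall>v \<in> fixed_vectors G m \<rho> - nullcone n G m \<rho>. \<exists>f \<in> plus_part m S. f v \<noteq> 0)"

text \<open>Such a \<open>d\<close> always exists, because the nullcone is already cut out by finitely many
  invariants (Hilbert's basis theorem).\<close>

definition delta_module ::
  "nat \<Rightarrow> 'k::field mat set \<Rightarrow> nat \<Rightarrow> ('k mat \<Rightarrow> 'k mat) \<Rightarrow> nat" where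
  "delta_module n G m \<rho> = (LEAST d. delta_set n G m \<rho> (invariant_ring_le n G m \<rho> d))"

definition delta :: "nat \<Rightarrow> 'k::field mat set \<Rightarrow> enat" where
  "delta n G = Sup {enat (delta_module n G m \<rho>) | m \<rho>. G_module n G m \<rho>}"

end

theory Submission
  imports Defs "Jordan_Normal_Form.Char_Poly" "HOL-Library.Function_Algebras"
begin

text \<open>
  By Kolchin's theorem \<open>G\<close> has a nonzero additive character \<open>\<chi> : G \<rightarrow> k\<close>, and connectedness makes its image
  infinite. For \<open>q = p\<^sup>e\<close> with \<open>e \<ge> 1\<close> let \<open>G\<close> act on \<open>k\<^sup>3\<close> by \<open>(x, y, z) \<mapsto> (x + a y, y, z - a\<^sup>q y)\<close>, \<open>a = \<chi>(g)\<close>.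
  The invariant \<open>x\<^sup>q + y\<^bsup>q-1\<^esup> z\<close> does not vanish at the fixed point \<open>(1, 0, 0)\<close>. Conversely, every
  invariant satisfies \<open>f(s, y, 0) = f(0, y, c s\<^sup>q)\<close> for \<open>y \<noteq> 0\<close> and some \<open>c\<close> depending on \<open>y\<close>, so if its
  degree is below \<open>q\<close> then \<open>f(s, y, 0)\<close> does not depend on \<open>s\<close>, first for \<open>y \<noteq> 0\<close> and then for \<open>y = 0\<close>.
  Hence \<open>\<delta>(G, k\<^sup>3) = q\<close>, which is unbounded in \<open>e\<close>.
\<close>

section \<open>Burnside's theorem and unipotent actions\<close>

text \<open>Matrices are functions on a finite index set, so that indices can be deleted without renumbering.\<close>

definition mm :: "'i set \<Rightarrow> ('a \<Rightarrow> 'i \<Rightarrow> 'k) \<Rightarrow> ('i \<Rightarrow> 'b \<Rightarrow> 'k) \<Rightarrow> 'a \<Rightarrow> 'b \<Rightarrow> 'k::comm_ring_1" where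
  "mm J A B = (\<lambda>i j. \<Sum>l\<in>J. A i l * B l j)"

definition mv :: "'i set \<Rightarrow> ('a \<Rightarrow> 'i \<Rightarrow> 'k) \<Rightarrow> ('i \<Rightarrow> 'k) \<Rightarrow> 'a \<Rightarrow> 'k::comm_ring_1" where
  "mv J A x = (\<lambda>i. \<Sum>l\<in>J. A i l * x l)"

definition tr :: "'i set \<Rightarrow> ('i \<Rightarrow> 'i \<Rightarrow> 'k) \<Rightarrow> 'k::comm_ring_1" where
  "tr J A = (\<Sum>i\<in>J. A i i)"

section \<open>Matrix products and the trace of a nilpotent matrix\<close>

lemma mm_assoc: "mm L (mm J A B) C = mm J A (mm L B C)"
  unfolding mm_def
  by (intro ext) (simp add: sum_distrib_left sum_distrib_right mult.assoc, rule sum.swap)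

lemma mv_mv: "mv L A (mv J B x) = mv J (mm L A B) x"
  unfolding mm_def mv_def
  by (intro ext) (simp add: sum_distrib_left sum_distrib_right mult.assoc, rule sum.swap)

lemma tr_mm_commute: "tr J (mm L A B) = tr L (mm J B A)"
  unfolding mm_def tr_def by (subst sum.swap) (simp add: mult.commute)

lemma mm_cong:
  "(\<And>l. l \<in> J \<Longrightarrow> A i l = A' i l) \<Longrightarrow> (\<And>l. l \<in> J \<Longrightarrow> B l j = B' l j) \<Longrightarrow> mm J A B i j = mm J A' B' i j"
  unfolding mm_def by (rule sum.cong) auto

lemma mv_cong: "(\<And>l. l \<in> J \<Longrightarrow> x l = y l) \<Longrightarrow> mv J A x = mv J A y"
  unfolding mv_def by (intro ext sum.cong) auto

text \<open>A relation \<open>X v = 0\<close> with \<open>v j = 1\<close> expresses column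
  \<open>j\<close> of \<open>X\<close> through the other columns; substituting it absorbs the term
  \<open>j\<close> into the rows of \<open>Y\<close>. Factorizations are shortened by one index in
  this way.\<close>

lemma mm_drop_column:
  assumes "finite L" "j \<in> L" "v j = 1" "mv L X v i = 0"
  shows "mm L X Y i b = mm (L - {j}) X (\<lambda>l b. Y l b - v l * Y j b) i b"
proof -
  have "X i j = - (\<Sum>l\<in>L - {j}. X i l * v l)"
    using assms by (simp add: mv_def sum.remove[of L j] add_eq_0_iff2)
  then show ?thesis
    using assms(1,2)
    by (simp add: mm_def sum.remove[of L j] sum_subtractf right_diff_distrib sum_distrib_right mult.assoc)
qed

text \<open>The transposed elimination: a relation \<open>w Y = 0\<close> among the rows of
  \<open>Y\<close> absorbs the term \<open>j\<close> into the columns of \<open>X\<close>.\<close>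

lemma mm_drop_row:
  assumes "finite L" "j \<in> L" "w j = 1" "(\<Sum>l\<in>L. w l * Y l b) = 0"
  shows "mm L X Y i b = mm (L - {j}) (\<lambda>i l. X i l - w l * X i j) Y i b"
proof -
  have "Y j b = - (\<Sum>l\<in>L - {j}. w l * Y l b)"
    using assms by (simp add: sum.remove[of L j] add_eq_0_iff2)
  then show ?thesis
    using assms(1,2)
    by (simp add: mm_def sum.remove[of L j] sum_subtractf left_diff_distrib sum_distrib_left mult.left_commute
        mult.assoc)
qed

text \<open>A nilpotent \<open>X\<close> kills some \<open>v\<close> with \<open>v j = 1\<close>.
  Dividing by the line of \<open>v\<close> gives a factorization \<open>X = X B\<close> through
  \<open>J - {j}\<close>, so \<open>X\<close> has the same trace as \<open>B X\<close> on the
  smaller index set. The latter is the induced map on the quotient and is nilpotent with the same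
  exponent.\<close>

lemma tr_nilpotent_eq_0:
  fixes X :: "'i \<Rightarrow> 'i \<Rightarrow> 'k::field"
  assumes "finite J" "\<And>x i. i \<in> J \<Longrightarrow> (mv J X ^^ k) x i = 0"
  shows "tr J X = 0"
  using assms
proof (induction "card J" arbitrary: J X)
  case 0
  then show ?case by (simp add: tr_def)
next
  case (Suc m)
  \<comment> \<open>Without a kernel vector the iterates of the all-ones vector would never vanish
    on \<open>J\<close>, against nilpotency.\<close>
  have "\<exists>v. (\<exists>j\<in>J. v j \<noteq> 0) \<and> (\<forall>i\<in>J. mv J X v i = 0)"
  proof (rule ccontr)
    assume c: "\<not> ?thesis"
    have "\<exists>j\<in>J. (mv J X ^^ r) (\<lambda>_. 1) j \<noteq> 0" for r
    proof (induction r)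
      case 0
      show ?case using Suc.hyps(2) by (cases "J = {}") auto
    next
      case (Suc r)
      then show ?case using c by auto
    qed
    with Suc.prems(2) show False by blast
  qed
  then obtain v0 j where v0: "j \<in> J" "v0 j \<noteq> 0" "\<forall>i\<in>J. mv J X v0 i = 0" by blast
  define v where "v = (\<lambda>l. v0 l / v0 j)"
  have v: "v j = 1" "\<And>i. i \<in> J \<Longrightarrow> mv J X v i = 0"
  proof -
    show "v j = 1" using v0 by (simp add: v_def)
    fix i assume "i \<in> J"
    have "mv J X v i = mv J X v0 i / v0 j" by (simp add: mv_def v_def sum_divide_distrib)
    with v0 \<open>i \<in> J\<close> show "mv J X v i = 0" by simp
  qed
  define L where "L = J - {j}"
  \<comment> \<open>\<open>B\<close> sends \<open>x\<close> to the coordinates of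
    \<open>x - x j * v\<close> outside \<open>j\<close>: it is the quotient map by the line of
    \<open>v\<close>.\<close>
  define B where "B = (\<lambda>l i. (if l = i then 1 else 0) - v l * (if j = i then 1 else 0 :: 'k))"
  have fin: "finite L" "finite J" using Suc.prems by (auto simp: L_def)
  have X: "X i b = mm L X B i b" if "i \<in> J" "b \<in> J" for i b
  proof -
    have "X i b = mm J X (\<lambda>l i. if l = i then 1 else 0) i b"
      using that fin by (simp add: mm_def if_distrib cong: if_cong)
    also have "\<dots> = mm L X B i b"
      unfolding L_def B_def by (rule mm_drop_column) (use v v0 fin that in auto)
    finally show ?thesis .
  qed
  define Y where "Y = mm J B X"
  \<comment> \<open>\<open>Y\<close> is the map that \<open>X\<close> induces on the
    quotient.\<close>
  have YB: "mv L Y (mv J B x) i = mv J B (mv J X x) i" for x i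
  proof -
    have "mv L Y (mv J B x) i = mv J (mm J B (mm L X B)) x i"
      by (simp add: mv_mv Y_def mm_assoc)
    also have "\<dots> = mv J (mm J B X) x i"
      unfolding mv_def by (intro sum.cong refl arg_cong2[of _ _ _ _ "(*)"] mm_cong) (simp_all add: X)
    finally show ?thesis by (simp add: mv_mv)
  qed
  have iter: "(mv L Y ^^ r) (mv J B x) = mv J B ((mv J X ^^ r) x)" for r x
    by (induction r) (auto simp: YB intro!: ext)
  have "tr L Y = 0"
  proof (rule Suc.hyps(1))
    show "m = card L" using Suc.hyps(2) v0(1) fin by (simp add: L_def)
    show "finite L" by fact
    fix z :: "'i \<Rightarrow> 'k" and i assume i: "i \<in> L"
    \<comment> \<open>Extension by zero at \<open>j\<close> is a section of \<open>B\<close>, so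
      every vector \<open>z\<close> on the quotient comes from some \<open>x\<close>.\<close>
    define x where "x = (\<lambda>l. if l = j then 0 else z l)"
    have z: "mv J B x l = z l" if "l \<in> L" for l
    proof -
      have "mv J B x l = (\<Sum>b\<in>J. (if l = b then x b else 0)) - v l * (\<Sum>b\<in>J. if j = b then x b else 0)"
        unfolding mv_def sum_distrib_left sum_subtractf[symmetric]
        by (rule sum.cong) (simp_all add: B_def left_diff_distrib)
      then show ?thesis using that v0(1) fin by (auto simp: L_def x_def)
    qed
    have "(mv L Y ^^ r) z i = (mv L Y ^^ r) (mv J B x) i" if "i \<in> L" for r i
      using that
    proof (induction r arbitrary: i)
      case (Suc r)
      then show ?case by (simp add: mv_def)
    qed (simp add: z)
    then have "(mv L Y ^^ k) z i = mv J B ((mv J X ^^ k) x) i"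
      using i by (simp add: iter)
    also have "\<dots> = 0" using Suc.prems(2) by (simp add: mv_def)
    finally show "(mv L Y ^^ k) z i = 0" .
  qed
  moreover have "tr J X = tr J (mm L X B)"
    unfolding tr_def by (rule sum.cong) (simp_all add: X)
  ultimately show ?case
    using tr_mm_commute[of J L X B] by (simp add: Y_def)
qed

section \<open>Linear spans of matrices and Burnside's theorem\<close>

lemma alg_closed_eigenvector:
  fixes M :: "'i \<Rightarrow> 'i \<Rightarrow> 'k::alg_closed_field"
  assumes "finite L" "L \<noteq> {}"
  shows "\<exists>c v. (\<exists>l\<in>L. v l \<noteq> 0) \<and> (\<forall>i\<in>L. mv L M v i = c * v i)"
proof -
  define m where "m = card L"
  obtain h where h: "bij_betw h {..<m} L"
    using ex_bij_betw_nat_finite[OF assms(1)] by (auto simp: m_def atLeast0LessThan)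
  define A where "A = mat m m (\<lambda>(i, j). M (h i) (h j))"
  have A: "A \<in> carrier_mat m m" by (simp add: A_def)
  have "degree (char_poly A) > 0"
    using degree_monic_char_poly[OF A] assms by (simp add: m_def card_gt_0_iff)
  then obtain c where "poly (char_poly A) c = 0" using alg_closed_imp_poly_has_root by blast
  then obtain w where "eigenvector A w c"
    using eigenvalue_root_char_poly[OF A] by (auto simp: eigenvalue_def)
  then have w: "w \<in> carrier_vec m" "w \<noteq> 0\<^sub>v m" "A *\<^sub>v w = c \<cdot>\<^sub>v w"
    using A by (auto simp: eigenvector_def)
  define g where "g = inv_into {..<m} h"
  have gh: "g (h i) = i" if "i < m" for i
    using h that by (auto simp: g_def bij_betw_def)
  have hL: "h i \<in> L" if "i < m" for i using h that by (auto simp: bij_betw_def)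
  have hg: "\<exists>i<m. h i = l" if "l \<in> L" for l using h that by (auto simp: bij_betw_def)
  obtain i0 where i0: "i0 < m" "w $ i0 \<noteq> 0" using w by (auto simp: vec_eq_iff)
  have "mv L M (\<lambda>l. w $ g l) (h i) = c * w $ i" if i: "i < m" for i
  proof -
    have "mv L M (\<lambda>l. w $ g l) (h i) = (\<Sum>j<m. M (h i) (h j) * w $ g (h j))"
      unfolding mv_def by (rule sum.reindex_bij_betw[OF h, symmetric])
    also have "\<dots> = (A *\<^sub>v w) $ i"
      using i w(1) by (simp add: A_def scalar_prod_def gh atLeast0LessThan)
    finally show ?thesis using i w(1) by (simp add: w(3))
  qed
  then show ?thesis
    using i0 gh hL hg by (intro exI[of _ c] exI[of _ "\<lambda>l. w $ g l"]) (metis gh)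
qed

text \<open>For finite \<open>J\<close> these are all the linear functionals on matrices indexed by
  \<open>J\<close>, with \<phi> as coefficients; hence the double annihilator below is the
  span.\<close>

definition pairing :: "'i set \<Rightarrow> ('i \<Rightarrow> 'i \<Rightarrow> 'k) \<Rightarrow> ('i \<Rightarrow> 'i \<Rightarrow> 'k) \<Rightarrow> 'k::comm_ring_1" where
  "pairing J \<phi> A = (\<Sum>i\<in>J. \<Sum>j\<in>J. \<phi> i j * A i j)"

text \<open>The linear span of \<open>S\<close>, as double annihilator; only the entries in \<open>J \<times> J\<close> matter.\<close>

definition mspan :: "'i set \<Rightarrow> ('i \<Rightarrow> 'i \<Rightarrow> 'k) set \<Rightarrow> ('i \<Rightarrow> 'i \<Rightarrow> 'k::comm_ring_1) set" where
  "mspan J S = {T. \<forall>\<phi>. (\<forall>A\<in>S. pairing J \<phi> A = 0) \<longrightarrow> pairing J \<phi> T = 0}"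

lemma pairing_tr: "pairing J \<phi> A = tr J (mm J (\<lambda>i j. \<phi> j i) A)"
  unfolding pairing_def tr_def mm_def by (subst sum.swap) simp

lemma tr_mm_pairing: "tr J (mm J A B) = pairing J (\<lambda>i j. A j i) B"
  by (simp add: pairing_tr)

lemma pairing_cong:
  "(\<And>i j. i \<in> J \<Longrightarrow> j \<in> J \<Longrightarrow> A i j = B i j) \<Longrightarrow> pairing J \<phi> A = pairing J \<phi> B"
  unfolding pairing_def by (intro sum.cong) auto

lemma mspan_base: "A \<in> S \<Longrightarrow> A \<in> mspan J S"
  by (simp add: mspan_def)

lemma mspan_cong:
  "T \<in> mspan J S \<Longrightarrow> (\<And>i j. i \<in> J \<Longrightarrow> j \<in> J \<Longrightarrow> T i j = T' i j) \<Longrightarrow> T' \<in> mspan J S"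
  unfolding mspan_def using pairing_cong[of J T T'] by simp

lemma mspan_diff_scale:
  assumes "T \<in> mspan J S" "T' \<in> mspan J S"
  shows "(\<lambda>i j. T i j - c * T' i j) \<in> mspan J S"
proof -
  have "pairing J \<phi> (\<lambda>i j. T i j - c * T' i j) = pairing J \<phi> T - c * pairing J \<phi> T'" for \<phi>
    by (simp add: pairing_def right_diff_distrib sum_subtractf sum_distrib_left mult_ac)
  then show ?thesis using assms by (simp add: mspan_def)
qed

text \<open>Cyclicity of the trace turns the pairing of \<phi> with \<open>A B\<close> into a
  functional of \<open>A\<close> alone or of \<open>B\<close> alone. So the claim passes from
  \<open>S\<close> to its span one factor at a time, first on the left and then on the
  right.\<close>

lemma mspan_mm:
  assumes S: "\<And>A B. A \<in> S \<Longrightarrow> B \<in> S \<Longrightarrow> mm J A B \<in> mspan J S"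
    and T: "T \<in> mspan J S" and T': "T' \<in> mspan J S"
  shows "mm J T T' \<in> mspan J S"
  unfolding mspan_def
proof (clarify)
  fix \<phi> assume \<phi>: "\<forall>A\<in>S. pairing J \<phi> A = 0"
  define \<psi> where "\<psi> = (\<lambda>i j. \<phi> j i)"
  have L: "pairing J \<phi> (mm J A B) = pairing J (\<lambda>i j. mm J B \<psi> j i) A"
    and R: "pairing J \<phi> (mm J A B) = pairing J (\<lambda>i j. mm J \<psi> A j i) B" for A B
  proof -
    have "pairing J \<phi> (mm J A B) = tr J (mm J \<psi> (mm J A B))"
      by (simp add: pairing_tr \<psi>_def)
    also have "\<dots> = tr J (mm J (mm J \<psi> A) B)" by (simp add: mm_assoc)
    finally show "pairing J \<phi> (mm J A B) = pairing J (\<lambda>i j. mm J \<psi> A j i) B"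
      by (simp only: tr_mm_pairing)
    have "tr J (mm J (mm J \<psi> A) B) = tr J (mm J (mm J B \<psi>) A)"
      unfolding tr_mm_commute[of J J "mm J \<psi> A"] by (simp add: mm_assoc)
    with \<open>pairing J \<phi> (mm J A B) = tr J (mm J \<psi> (mm J A B))\<close>
    have "pairing J \<phi> (mm J A B) = tr J (mm J (mm J B \<psi>) A)"
      by (simp add: mm_assoc)
    then show "pairing J \<phi> (mm J A B) = pairing J (\<lambda>i j. mm J B \<psi> j i) A"
      by (simp only: tr_mm_pairing)
  qed
  have "pairing J \<phi> (mm J T B) = 0" if "B \<in> S" for B
  proof -
    have "pairing J (\<lambda>i j. mm J B \<psi> j i) A = 0" if "A \<in> S" for A
      using S[OF that \<open>B \<in> S\<close>] \<phi> by (simp add: mspan_def L[symmetric])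
    then show ?thesis using T by (simp add: mspan_def L)
  qed
  then show "pairing J \<phi> (mm J T T') = 0"
    using T' unfolding R by (simp add: mspan_def)
qed

text \<open>The argument of Lomonosov and Rosenthal for Burnside's theorem, with the rank of a matrix
  measured by the number of terms in a factorization \<open>X Y\<close>.\<close>

lemma mspan_rank_one:
  fixes S :: "('i \<Rightarrow> 'i \<Rightarrow> 'k::alg_closed_field) set"
  assumes J: "finite J" "J \<noteq> {}"
    and mult: "\<And>A B. A \<in> S \<Longrightarrow> B \<in> S \<Longrightarrow> mm J A B \<in> mspan J S"
    and trans: "\<And>x y. \<exists>i\<in>J. x i \<noteq> 0 \<Longrightarrow> \<exists>i\<in>J. y i \<noteq> 0 \<Longrightarrow>
      \<exists>A\<in>S. (\<Sum>i\<in>J. y i * mv J A x i) \<noteq> 0"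
  shows "\<exists>x y. (\<exists>i\<in>J. x i \<noteq> 0) \<and> (\<exists>i\<in>J. y i \<noteq> 0) \<and> (\<lambda>i j. x i * y j) \<in> mspan J S"
proof -
  define P where "P = (\<lambda>r. \<exists>L X Y. L \<subseteq> J \<and> card L = r \<and> mm L X Y \<in> mspan J S \<and>
    (\<exists>i\<in>J. \<exists>j\<in>J. mm L X Y i j \<noteq> 0))"
  have "\<exists>r. P r"
  proof -
    \<comment> \<open>Transitivity at the all-ones vectors supplies a nonzero matrix, which factors
      trivially through all of \<open>J\<close>.\<close>
    obtain A where "A \<in> S" "(\<Sum>i\<in>J. 1 * mv J A (\<lambda>_. 1) i) \<noteq> 0"
      using trans[of "\<lambda>_. 1" "\<lambda>_. 1"] J by auto
    then have nz: "\<exists>i\<in>J. \<exists>j\<in>J. A i j \<noteq> 0"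
      by (auto simp: mv_def intro!: sum.neutral)
    have eq: "mm J A (\<lambda>i j. if i = j then 1 else 0) i j = A i j" if "j \<in> J" for i j
      using that J by (simp add: mm_def if_distrib cong: if_cong)
    have "mm J A (\<lambda>i j. if i = j then 1 else 0) \<in> mspan J S"
      by (rule mspan_cong[OF mspan_base[OF \<open>A \<in> S\<close>]]) (simp add: eq)
    then have "P (card J)" unfolding P_def using nz eq by (metis subset_refl)
    then show ?thesis by blast
  qed
  define r where "r = (LEAST r. P r)"
  have "P r" unfolding r_def using \<open>\<exists>r. P r\<close> by (rule LeastI_ex)
  then obtain L X Y where L: "L \<subseteq> J" "card L = r" and T: "mm L X Y \<in> mspan J S"
    and Tnz: "\<exists>i\<in>J. \<exists>j\<in>J. mm L X Y i j \<noteq> 0"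
    unfolding P_def by blast
  have finL: "finite L" using L J finite_subset by blast
  \<comment> \<open>Minimality of \<open>r\<close>: a matrix of the span that factors through
    \<open>L\<close> with one index removed vanishes.\<close>
  have min: "X' i j = 0" if "X' \<in> mspan J S" "l \<in> L" "i \<in> J" "j \<in> J"
    "\<And>i j. i \<in> J \<Longrightarrow> j \<in> J \<Longrightarrow> X' i j = mm (L - {l}) A B i j" for X' l A B i j
  proof (rule ccontr)
    assume "X' i j \<noteq> 0"
    moreover have "mm (L - {l}) A B \<in> mspan J S"
      by (rule mspan_cong[OF that(1)]) (rule that(5))
    ultimately have "P (card (L - {l}))"
      unfolding P_def using that L by (intro exI[of _ "L - {l}"] exI[of _ A] exI[of _ B]) auto
    then have "r \<le> card (L - {l})" unfolding r_def by (rule Least_le)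
    moreover have "card (L - {l}) < card L" using finL that(2) by (rule card_Diff1_less)
    ultimately show False using L by simp
  qed
  \<comment> \<open>The columns of \<open>X\<close> are linearly independent, since a relation among
    them would shorten the factorization. The next fact is the same for the rows of
    \<open>Y\<close>.\<close>
  have colX: "\<exists>i\<in>J. mv L X v i \<noteq> 0" if "l \<in> L" "v l \<noteq> 0" for v l
  proof (rule ccontr)
    assume c: "\<not> ?thesis"
    define w where "w = (\<lambda>m. v m / v l)"
    have w: "w l = 1" using that by (simp add: w_def)
    have "mv L X w i = mv L X v i / v l" for i
      by (simp add: mv_def w_def sum_divide_distrib)
    then have "mm L X Y i j = mm (L - {l}) X (\<lambda>m b. Y m b - w m * Y l b) i j" if "i \<in> J" for i j
      using that c by (intro mm_drop_column[where v = w, OF finL \<open>l \<in> L\<close> w]) simp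
    from min[OF T \<open>l \<in> L\<close> _ _ this] Tnz show False by blast
  qed
  have rowY: "\<exists>b\<in>J. (\<Sum>m\<in>L. v m * Y m b) \<noteq> 0" if "l \<in> L" "v l \<noteq> 0" for v l
  proof (rule ccontr)
    assume c: "\<not> ?thesis"
    define w where "w = (\<lambda>m. v m / v l)"
    have w: "w l = 1" using that by (simp add: w_def)
    have "(\<Sum>m\<in>L. w m * Y m b) = (\<Sum>m\<in>L. v m * Y m b) / v l" for b
      by (simp add: w_def sum_divide_distrib)
    then have "mm L X Y i j = mm (L - {l}) (\<lambda>i m. X i m - w m * X i l) Y i j" if "j \<in> J" for i j
      using that c by (intro mm_drop_row[where w = w, OF finL \<open>l \<in> L\<close> w]) simp
    from min[OF T \<open>l \<in> L\<close> _ _ this] Tnz show False by blast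
  qed
  have "L \<noteq> {}" using Tnz by (auto simp: mm_def)
  \<comment> \<open>With \<open>M = Y A X\<close>, an eigenvalue \<open>c\<close> of
    \<open>M\<close> and \<open>T = X Y\<close>, the matrix \<open>T A T - c T = X (M - c) Y\<close>
    lies in the span and has a shorter factorization than \<open>T\<close>, hence is zero.
    Independence of the columns of \<open>X\<close> and of the rows of \<open>Y\<close> then forces
    \<open>M = c\<close>.\<close>
  have scalar: "\<exists>c. \<forall>l\<in>L. \<forall>m\<in>L. mm J Y (mm J A X) l m = (if l = m then c else 0)" if A: "A \<in> S" for A
  proof -
    define M where "M = mm J Y (mm J A X)"
    obtain c v0 where "\<exists>l\<in>L. v0 l \<noteq> 0" and v0: "\<forall>i\<in>L. mv L M v0 i = c * v0 i"
      using alg_closed_eigenvector[OF finL \<open>L \<noteq> {}\<close>, of M] by blast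
    then obtain l where l: "l \<in> L" "v0 l \<noteq> 0" by blast
    define v where "v = (\<lambda>m. v0 m / v0 l)"
    have vl: "v l = 1" using l by (simp add: v_def)
    define E where "E = (\<lambda>i j. M i j - (if i = j then c else 0))"
    have Ev: "mv L E v i = 0" if "i \<in> L" for i
    proof -
      have "mv L E v i = mv L M v i - (\<Sum>m\<in>L. if i = m then c * v m else 0)"
        unfolding mv_def sum_subtractf[symmetric] by (rule sum.cong) (simp_all add: E_def left_diff_distrib)
      also have "mv L M v i = mv L M v0 i / v0 l"
        by (simp add: mv_def v_def sum_divide_distrib)
      finally have "mv L E v i = mv L M v0 i / v0 l - c * v0 i / v0 l"
        using that finL by (simp add: v_def)
      then show ?thesis using v0 that by simp
    qed
    let ?T = "mm L X Y"
    define T' where "T' = (\<lambda>i j. mm J ?T (mm J A ?T) i j - c * ?T i j)"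
    have T': "T' \<in> mspan J S"
      unfolding T'_def using mspan_base[OF A] T
      by (intro mspan_diff_scale mspan_mm[OF mult])
    have "mm J ?T (mm J A ?T) = mm L (mm L X M) Y" 
      by (simp add: M_def mm_assoc)
    moreover have "mm L (mm L X E) Y i j = mm L (mm L X M) Y i j - c * ?T i j" for i j
    proof -
      have "mm L X E i m = mm L X M i m - c * X i m" if "m \<in> L" for m
        using that finL
        by (simp add: mm_def E_def right_diff_distrib sum_subtractf if_distrib[of "(*) _"]
            mult.commute cong: if_cong)
      then have "mm L (mm L X E) Y i j = (\<Sum>m\<in>L. (mm L X M i m - c * X i m) * Y m j)"
        unfolding mm_def[of L "mm L X E"] by simp
      then show ?thesis
        by (simp add: mm_def[of L "mm L X M"] mm_def[of L X Y] left_diff_distrib sum_subtractf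
            sum_distrib_left mult.assoc)
    qed
    ultimately have T'_eq: "T' i j = mm L (mm L X E) Y i j" for i j
      by (simp add: T'_def)
    have "mv L (mm L X E) v i = 0" for i
      using Ev by (simp add: mv_mv[symmetric] mv_def[of L X])
    then have "T' i j = mm (L - {l}) (mm L X E) (\<lambda>m b. Y m b - v m * Y l b) i j" for i j
      unfolding T'_eq by (intro mm_drop_column[where v = v, OF finL l(1) vl])
    from min[OF T' l(1) _ _ this] have T'0: "T' i j = 0" if "i \<in> J" "j \<in> J" for i j
      using that by blast
    have EY: "mm L E Y m j = 0" if "m \<in> L" "j \<in> J" for m j
    proof (rule ccontr)
      assume "mm L E Y m j \<noteq> 0"
      from colX[OF \<open>m \<in> L\<close>, of "\<lambda>m. mm L E Y m j", OF this] obtain i where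
        "i \<in> J" "mv L X (\<lambda>m. mm L E Y m j) i \<noteq> 0" by blast
      moreover have "mv L X (\<lambda>m. mm L E Y m j) i = T' i j"
        by (simp add: T'_eq mm_assoc) (simp add: mv_def mm_def)
      ultimately show False using T'0 that by simp
    qed
    have "E m m' = 0" if "m \<in> L" "m' \<in> L" for m m'
    proof (rule ccontr)
      assume "E m m' \<noteq> 0"
      from rowY[OF \<open>m' \<in> L\<close>, of "E m", OF this] EY[OF \<open>m \<in> L\<close>] show False
        by (auto simp: mm_def)
    qed
    then show ?thesis unfolding E_def M_def by (intro exI[of _ c]) (simp split: if_splits)
  qed
  obtain l where l: "l \<in> L" using \<open>L \<noteq> {}\<close> by blast
  have colnz: "\<exists>i\<in>J. X i m \<noteq> 0" if "m \<in> L" for m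
    using colX[OF that, of "\<lambda>k. if k = m then 1 else 0"] that finL
    by (simp add: mv_def if_distrib cong: if_cong)
  have rownz: "\<exists>i\<in>J. Y m i \<noteq> 0" if "m \<in> L" for m
    using rowY[OF that, of "\<lambda>k. if k = m then 1 else 0"] that finL
    by (simp add: if_distrib[of "\<lambda>x. x * _"] cong: if_cong)
  \<comment> \<open>For two different indices in \<open>L\<close>, transitivity would make an
    off-diagonal entry of some \<open>Y A X\<close> nonzero, although all these matrices are scalar.
    So the minimal rank is one.\<close>
  have "m = l" if m: "m \<in> L" for m
  proof (rule ccontr)
    assume "m \<noteq> l"
    obtain A where A: "A \<in> S" "(\<Sum>i\<in>J. Y m i * mv J A (\<lambda>i. X i l) i) \<noteq> 0"
      using trans[OF colnz[OF l] rownz[OF m]] by blast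
    with scalar[OF A(1)] l m \<open>m \<noteq> l\<close> show False by (auto simp: mm_def mv_def)
  qed
  then have "L = {l}" using l by blast
  then have "mm L X Y = (\<lambda>i j. X i l * Y l j)" by (simp add: mm_def)
  with T colnz[OF l] rownz[OF l] show ?thesis by (intro exI[of _ "\<lambda>i. X i l"] exI[of _ "Y l"]) auto
qed

text \<open>For \<open>D = A - 1\<close> the trace of \<open>D B\<close> is \<open>t - t = 0\<close>
  for \<open>B\<close> in \<open>S\<close>, hence for \<open>B\<close> in the span. Inserting
  \<open>H' T H\<close>, where \<open>T\<close> is the rank one matrix given by \<open>x\<close> and
  \<open>y\<close>, yields \<open>y H D H' x = 0\<close> for all \<open>H\<close> and
  \<open>H'\<close> in \<open>S\<close>. Transitivity, used once on each side, gives
  \<open>D = 0\<close>.\<close>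

lemma transitive_constant_trace_trivial:
  fixes S :: "('i \<Rightarrow> 'i \<Rightarrow> 'k::alg_closed_field) set"
  assumes J: "finite J"
    and mult: "\<And>A B. A \<in> S \<Longrightarrow> B \<in> S \<Longrightarrow> \<exists>C\<in>S. \<forall>i\<in>J. \<forall>j\<in>J. C i j = mm J A B i j"
    and trace: "\<And>A. A \<in> S \<Longrightarrow> tr J A = t"
    and trans: "\<And>x y. \<exists>i\<in>J. x i \<noteq> 0 \<Longrightarrow> \<exists>i\<in>J. y i \<noteq> 0 \<Longrightarrow>
      \<exists>A\<in>S. (\<Sum>i\<in>J. y i * mv J A x i) \<noteq> 0"
    and A: "A \<in> S" and i: "i \<in> J" and j: "j \<in> J"
  shows "A i j = (if i = j then 1 else 0)"
proof -
  have mult': "mm J A B \<in> mspan J S" if "A \<in> S" "B \<in> S" for A B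
    using mult[OF that] mspan_base mspan_cong by metis
  obtain x y where x: "\<exists>i\<in>J. x i \<noteq> 0" and y: "\<exists>i\<in>J. y i \<noteq> 0"
    and T: "(\<lambda>i j. x i * y j) \<in> mspan J S"
    using mspan_rank_one[OF J _ mult' trans] i by blast
  define I where "I = (\<lambda>(i::'i) j. if i = j then 1 else 0 :: 'k)"
  define D where "D = (\<lambda>i j. A i j - I i j)"
  have ID: "mm J I C a b = C a b" if "a \<in> J" for C :: "'i \<Rightarrow> 'i \<Rightarrow> 'k" and a b
    using that J by (simp add: mm_def I_def if_distrib[of "\<lambda>x. x * _"] cong: if_cong)
  have trD: "tr J (mm J D C) = tr J (mm J A C) - tr J C" for C
  proof -
    have "tr J (mm J D C) = tr J (mm J A C) - tr J (mm J I C)"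
      by (simp add: tr_def mm_def D_def left_diff_distrib sum_subtractf)
    also have "tr J (mm J I C) = tr J C"
      unfolding tr_def by (rule sum.cong) (simp_all add: ID)
    finally show ?thesis .
  qed
  have tr0: "tr J (mm J D C) = 0" if "C \<in> mspan J S" for C
  proof -
    have "tr J (mm J D B) = 0" if B: "B \<in> S" for B
    proof -
      obtain C where C: "C \<in> S" "\<forall>i\<in>J. \<forall>j\<in>J. C i j = mm J A B i j" using mult[OF A B] by blast
      then have "tr J (mm J A B) = tr J C" by (simp add: tr_def)
      then show ?thesis using trace B C by (simp add: trD)
    qed
    then show ?thesis using that by (simp add: tr_mm_pairing mspan_def)
  qed
  have form0: "(\<Sum>i\<in>J. y i * mv J H (mv J D (mv J H' x)) i) = 0" if "H \<in> S" "H' \<in> S" for H H'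
  proof -
    let ?T = "\<lambda>i j. x i * y j"
    have "tr J (mm J D (mm J H' (mm J ?T H))) = 0"
      by (intro tr0 mspan_mm[OF mult'] T mspan_base that)
    also have "tr J (mm J D (mm J H' (mm J ?T H))) = tr J (mm J ?T (mm J H (mm J D H')))"
      using tr_mm_commute[of J J "mm J D H'" "mm J ?T H"] by (simp add: mm_assoc)
    also have "\<dots> = (\<Sum>i\<in>J. y i * mv J (mm J H (mm J D H')) x i)"
      unfolding tr_def mm_def[of J ?T] mv_def
      by (subst sum.swap) (simp add: sum_distrib_left mult_ac)
    finally show ?thesis by (simp add: mv_mv)
  qed
  have DH: "mv J D (mv J H' x) a = 0" if "H' \<in> S" "a \<in> J" for H' a
    using trans[of "mv J D (mv J H' x)" y] y form0 that by blast
  \<comment> \<open>A nonzero entry would make row \<open>i\<close> of \<open>D\<close> a nonzero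
    functional, which by transitivity does not vanish on all \<open>H x\<close>.\<close>
  have "D i j = 0"
  proof (rule ccontr)
    assume "D i j \<noteq> 0"
    then obtain H where "H \<in> S" "(\<Sum>a\<in>J. D i a * mv J H x a) \<noteq> 0"
      using trans[of x "D i"] x j by blast
    with DH[of H i] i show False by (simp add: mv_def[of J D])
  qed
  then show ?thesis by (simp add: D_def I_def)
qed

section \<open>Invariant subspaces of unipotent actions\<close>

lemma (in vector_space) dim_less_of_psubset:
  assumes "subspace W" "subspace U" "W \<subset> U" "U \<subseteq> span F" "finite F"
  shows "dim W < dim U"
proof -
  obtain B where B: "B \<subseteq> W" "independent B" "W \<subseteq> span B"
    using maximal_independent_subset_extend[of "{}" W] by (auto simp: dependent_def)
  obtain C where C: "B \<subseteq> C" "C \<subseteq> U" "independent C" "U \<subseteq> span C"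
    using maximal_independent_subset_extend[of B U] B assms by blast
  have fin: "finite C" using independent_span_bound[of F C] C assms by blast
  have "span B = W" using span_subspace B assms by blast
  then have "B \<noteq> C" using C assms by auto
  then have "card B < card C" using C(1) fin by (intro psubset_card_mono) auto
  then show ?thesis using basis_card_eq_dim[of B W] basis_card_eq_dim[of C U] B C by simp
qed

text \<open>Kolchin's theorem, in the form that yields additive characters: \<open>g \<mapsto> g u - u\<close> is a
  homomorphism into the fixed space.\<close>

lemma unipotent_action_fixed_differences:
  fixes scale :: "'k::alg_closed_field \<Rightarrow> 'v::ab_group_add \<Rightarrow> 'v"
  assumes vs: "vector_space scale"
    and V: "module.subspace scale V" "V \<subseteq> module.span scale F" "finite F"
    and lin: "\<And>g. g \<in> G \<Longrightarrow> Vector_Spaces.linear scale scale g"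
    and inv: "\<And>g v. g \<in> G \<Longrightarrow> v \<in> V \<Longrightarrow> g v \<in> V"
    and one: "(\<lambda>v. v) \<in> G"
    and comp: "\<And>g h. g \<in> G \<Longrightarrow> h \<in> G \<Longrightarrow> (\<lambda>v. g (h v)) \<in> G"
    and unip: "\<And>g. g \<in> G \<Longrightarrow> \<exists>r. \<forall>v\<in>V. ((\<lambda>v. g v - v) ^^ r) v = 0"
    and nontriv: "\<exists>g\<in>G. \<exists>v\<in>V. g v \<noteq> v"
  shows "\<exists>u\<in>V. (\<exists>g\<in>G. g u \<noteq> u) \<and> (\<forall>g\<in>G. \<forall>h\<in>G. h (g u - u) = g u - u)"
proof -
  interpret vector_space scale by fact
  interpret P: vector_space_pair scale scale by (intro_locales)
  note lin_simps = P.linear_add[OF lin] P.linear_scale[OF lin] P.linear_diff[OF lin] P.linear_sum[OF lin]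
    P.linear_0[OF lin]
  define Q where "Q = (\<lambda>U. subspace U \<and> U \<subseteq> V \<and> (\<forall>g\<in>G. \<forall>u\<in>U. g u \<in> U))"
  define R where "R = (\<lambda>U. Q U \<and> (\<exists>g\<in>G. \<exists>u\<in>U. g u \<noteq> u))"
  have "R V" using V inv nontriv by (auto simp: R_def Q_def)
  \<comment> \<open>An invariant subspace of least dimension among those with nontrivial action; on
    each proper invariant subspace of \<open>U\<close> the action is then trivial.\<close>
  define U where "U = arg_min dim R"
  have RU: "R U" and minU: "\<And>W. R W \<Longrightarrow> dim U \<le> dim W"
    using arg_min_nat_lemma[where P = R and m = dim, OF \<open>R V\<close>] by (auto simp: U_def)
  then have U: "subspace U" "U \<subseteq> V" and invU: "\<And>g u. g \<in> G \<Longrightarrow> u \<in> U \<Longrightarrow> g u \<in> U"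
    by (auto simp: R_def Q_def)
  have proper: "g w = w" if "subspace W" "W \<subset> U" "\<And>g w. g \<in> G \<Longrightarrow> w \<in> W \<Longrightarrow> g w \<in> W"
    "g \<in> G" "w \<in> W" for W g w
  proof (rule ccontr)
    assume "g w \<noteq> w"
    with that U have "R W" by (auto simp: R_def Q_def)
    moreover have "dim W < dim U"
      by (rule dim_less_of_psubset[of _ _ F]) (use that U V in auto)
    ultimately show False using minU by fastforce
  qed
  \<comment> \<open>\<open>N\<close> contains every proper invariant subspace of \<open>U\<close>,
    so \<open>U / N\<close> is irreducible. The aim is that \<open>G\<close> acts trivially on
    \<open>U / N\<close>.\<close>
  define N where "N = {u\<in>U. \<forall>g\<in>G. g u = u}"
  have N: "subspace N" "N \<subseteq> U"
    using U(1) by (auto simp: N_def subspace_def lin_simps)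
  obtain BN where BN: "BN \<subseteq> N" "independent BN" "N \<subseteq> span BN"
    using maximal_independent_subset_extend[of "{}" N] by (auto simp: dependent_def)
  obtain BU where BU: "BN \<subseteq> BU" "BU \<subseteq> U" "independent BU" "U \<subseteq> span BU"
    using maximal_independent_subset_extend[of BN U] BN N by blast
  have fin: "finite BU"
    using independent_span_bound[of F BU] BU U V by blast
  have spanU: "span BU = U" and spanN: "span BN = N"
    using span_subspace BU BN U N by blast+
  \<comment> \<open>The basis vectors beyond those of \<open>N\<close> represent a basis of
    \<open>U / N\<close>; \<open>\<rho> h\<close> below is the matrix that \<open>h\<close> induces
    there.\<close>
  define J where "J = BU - BN"
  have J: "finite J" "J \<subseteq> U" using fin BU by (auto simp: J_def)
  define \<phi> where "\<phi> = (\<lambda>b u. representation BU u b)"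
  have \<phi>_add: "\<phi> b (u + v) = \<phi> b u + \<phi> b v"
    and \<phi>_diff: "\<phi> b (u - v) = \<phi> b u - \<phi> b v" if "u \<in> U" "v \<in> U" for b u v
    using that BU(3) by (simp_all add: \<phi>_def representation_add representation_diff spanU)
  have \<phi>_scale: "\<phi> b (scale c u) = c * \<phi> b u" if "u \<in> U" for b c u
    using that BU(3) by (simp add: \<phi>_def representation_scale spanU)
  have \<phi>_sum: "\<phi> b (sum f A) = (\<Sum>a\<in>A. \<phi> b (f a))" if "\<And>a. a \<in> A \<Longrightarrow> f a \<in> U" for b A and f :: "'v \<Rightarrow> 'v"
    using that BU(3) by (simp add: \<phi>_def representation_sum spanU)
  have \<phi>_basis: "\<phi> b c = (if b = c then 1 else 0)" if "c \<in> BU" for b c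
    using that BU(3) by (simp add: \<phi>_def representation_basis)
  have \<phi>_N: "\<phi> b u = 0" if "u \<in> N" "b \<in> J" for b u
    using representation_extend[OF BU(3) _ BU(1), of u] that representation_ne_zero[of BN u b]
    by (auto simp: \<phi>_def spanN J_def)
  have expand: "u = (\<Sum>b\<in>BU. scale (\<phi> b u) b)" if "u \<in> U" for u
    using sum_representation_eq[OF BU(3), of u BU] fin that by (simp add: \<phi>_def spanU)
  define \<rho> where "\<rho> = (\<lambda>(h :: 'v \<Rightarrow> 'v) b c. \<phi> b (h c))"
  have \<rho>: "\<phi> b (h u) = mv J (\<rho> h) (\<lambda>c. \<phi> c u) b"
    if h: "Vector_Spaces.linear scale scale h" "\<And>u. u \<in> U \<Longrightarrow> h u \<in> U" "\<And>u. u \<in> N \<Longrightarrow> h u \<in> N"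
      and "u \<in> U" "b \<in> J" for h b u
  proof -
    have "\<phi> b (h u) = \<phi> b (\<Sum>c\<in>BU. scale (\<phi> c u) (h c))"
      using arg_cong[OF expand[OF \<open>u \<in> U\<close>], of h] by (simp add: P.linear_sum[OF h(1)] P.linear_scale[OF h(1)])
    also have "\<dots> = (\<Sum>c\<in>BU. \<phi> c u * \<phi> b (h c))"
      using BU(2) h(2) U(1) by (subst \<phi>_sum) (auto simp: \<phi>_scale subspace_scale intro!: sum.cong)
    also have "\<dots> = (\<Sum>c\<in>J. \<phi> c u * \<phi> b (h c))"
      unfolding J_def using fin BN(1) h(3) \<phi>_N \<open>b \<in> J\<close> by (intro sum.mono_neutral_right) auto
    finally show ?thesis by (simp add: mv_def \<rho>_def mult.commute)
  qed
  have fixN: "g u = u" if "g \<in> G" "u \<in> N" for g u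
    using that unfolding N_def by blast
  have gN: "g u \<in> N" if "g \<in> G" "u \<in> N" for g u
    using that by (simp add: fixN)
  define vec where "vec = (\<lambda>x. \<Sum>b\<in>J. scale (x b) b)"
  have vecU: "vec x \<in> U" for x
    unfolding vec_def using J U by (auto intro!: subspace_sum subspace_scale)
  have \<phi>_vec: "\<phi> b (vec x) = x b" if "b \<in> J" for b x
  proof -
    have "\<phi> b (vec x) = (\<Sum>c\<in>J. x c * \<phi> b c)"
      unfolding vec_def using J U by (subst \<phi>_sum) (auto simp: \<phi>_scale subspace_scale intro!: sum.cong)
    also have "\<dots> = (\<Sum>c\<in>J. if b = c then x c else 0)"
      by (rule sum.cong) (auto simp: \<phi>_basis J_def)
    finally show ?thesis using that J by simp
  qed
  \<comment> \<open>On \<open>U / N\<close> every trace equals \<open>card J\<close>, because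
    \<open>g - 1\<close> is nilpotent, and irreducibility provides transitivity.\<close>
  have triv: "\<rho> g b c = (if b = c then 1 else 0)" if g: "g \<in> G" and bc: "b \<in> J" "c \<in> J" for g b c
  proof (rule transitive_constant_trace_trivial[where J = J and S = "\<rho> ` G" and t = "of_nat (card J)"])
    show "finite J" by fact
    show "\<rho> g \<in> \<rho> ` G" "b \<in> J" "c \<in> J" using that by auto
    show "\<exists>C\<in>\<rho> ` G. \<forall>i\<in>J. \<forall>j\<in>J. C i j = mm J A B i j" if AB: "A \<in> \<rho> ` G" "B \<in> \<rho> ` G" for A B
    proof -
      obtain g h where gh: "A = \<rho> g" "B = \<rho> h" "g \<in> G" "h \<in> G" using AB by auto
      have "\<rho> (\<lambda>v. g (h v)) i j = mm J A B i j" if "i \<in> J" "j \<in> J" for i j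
        using \<rho>[OF lin[OF gh(3)] invU[OF gh(3)] gN[OF gh(3)], of "h j" i] that J(2) invU[OF gh(4)]
        by (auto simp: gh \<rho>_def mv_def mm_def)
      then show ?thesis using comp[OF gh(3,4)] by blast
    qed
  next
    fix A assume "A \<in> \<rho> ` G"
    then obtain g where g: "A = \<rho> g" "g \<in> G" by auto
    define D where "D = (\<lambda>v. g v - v)"
    have linD: "Vector_Spaces.linear scale scale D"
      unfolding D_def Vector_Spaces.linear_iff using lin_simps(1,2)[OF g(2)]
      by (auto simp: algebra_simps vector_space_axioms)
    have DU: "D u \<in> U" if "u \<in> U" for u
      unfolding D_def using that invU[OF g(2)] U(1) by (intro subspace_diff) auto
    have DN: "D u \<in> N" if "u \<in> N" for u
      using subspace_0[OF N(1)] by (simp add: D_def fixN[OF g(2) that])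
    obtain r where r: "\<And>v. v \<in> V \<Longrightarrow> (D ^^ r) v = 0" using unip[OF g(2)] by (auto simp: D_def)
    have pow: "(D ^^ k) u \<in> U" "\<forall>b\<in>J. (mv J (\<rho> D) ^^ k) x b = \<phi> b ((D ^^ k) u)"
      if "u \<in> U" "\<forall>b\<in>J. x b = \<phi> b u" for k u x
    proof -
      show m: "(D ^^ k) u \<in> U" for k using that by (induction k) (auto intro: DU)
      show "\<forall>b\<in>J. (mv J (\<rho> D) ^^ k) x b = \<phi> b ((D ^^ k) u)"
      proof (induction k)
        case 0
        show ?case using that by simp
      next
        case (Suc k)
        have "mv J (\<rho> D) ((mv J (\<rho> D) ^^ k) x) = mv J (\<rho> D) (\<lambda>b. \<phi> b ((D ^^ k) u))"
          using Suc by (intro mv_cong) auto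
        then show ?case using \<rho>[OF linD DU DN m] by simp
      qed
    qed
    have "tr J (\<rho> D) = 0"
    proof (rule tr_nilpotent_eq_0[where k = r])
      show "finite J" by fact
      fix x i assume "i \<in> J"
      then have "(mv J (\<rho> D) ^^ r) x i = \<phi> i ((D ^^ r) (vec x))"
        using pow(2)[of "vec x" x r] vecU \<phi>_vec by simp
      also have "(D ^^ r) (vec x) = 0" using r vecU U by blast
      finally show "(mv J (\<rho> D) ^^ r) x i = 0" by (simp add: \<phi>_def representation_zero)
    qed
    moreover have "\<rho> D b b = \<rho> g b b - 1" if "b \<in> J" for b
    proof -
      have "b \<in> U" "g b \<in> U" using that J(2) invU[OF g(2)] by auto
      then have "\<rho> D b b = \<phi> b (g b) - \<phi> b b" by (simp add: \<rho>_def D_def \<phi>_diff)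
      moreover have "\<phi> b b = 1" using that by (subst \<phi>_basis) (auto simp: J_def)
      ultimately show ?thesis by (simp add: \<rho>_def)
    qed
    then have "tr J (\<rho> D) = tr J (\<rho> g) - of_nat (card J)"
      by (simp add: tr_def sum_subtractf)
    ultimately show "tr J A = of_nat (card J)" by (simp add: g)
  next
    fix x y :: "'v \<Rightarrow> 'k"
    assume x: "\<exists>i\<in>J. x i \<noteq> 0" and y: "\<exists>i\<in>J. y i \<noteq> 0"
    define \<psi> where "\<psi> = (\<lambda>u. \<Sum>b\<in>J. y b * \<phi> b u)"
    \<comment> \<open>\<open>W\<close> is the largest invariant subspace in the kernel of \<psi>. It
      is proper, hence inside \<open>N\<close>, whereas \<open>vec x\<close> is not in
      \<open>N\<close>; so some \<open>g\<close> moves \<open>vec x\<close> out of the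
      kernel.\<close>
    define W where "W = {w\<in>U. \<forall>g\<in>G. \<psi> (g w) = 0}"
    have "vec x \<notin> N" using x \<phi>_N \<phi>_vec by metis
    have \<psi>_lin: "\<psi> (u + v) = \<psi> u + \<psi> v" "\<psi> (scale c u) = c * \<psi> u" if "u \<in> U" "v \<in> U" for u v c
      using that by (simp_all add: \<psi>_def \<phi>_add \<phi>_scale distrib_left sum.distrib sum_distrib_left mult_ac)
    have \<psi>0: "\<psi> 0 = 0" by (simp add: \<psi>_def \<phi>_def representation_zero)
    have subW: "subspace W"
      using U(1) invU by (auto simp: W_def subspace_def lin_simps \<psi>_lin \<psi>0)
    obtain b where b: "b \<in> J" "y b \<noteq> 0" using y by blast
    have "\<psi> b = (\<Sum>c\<in>J. if c = b then y c else 0)"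
      unfolding \<psi>_def using b by (intro sum.cong) (auto simp: \<phi>_basis J_def)
    then have "\<psi> b \<noteq> 0" using b J by simp
    then have "b \<notin> W" using one by (auto simp: W_def)
    then have "W \<subset> U" using b J by (auto simp: W_def)
    moreover have "g w \<in> W" if "g \<in> G" "w \<in> W" for g w
      using that invU comp by (auto simp: W_def)
    ultimately have "W \<subseteq> N" using proper[OF subW] by (auto simp: N_def)
    then obtain g where g: "g \<in> G" "\<psi> (g (vec x)) \<noteq> 0"
      using \<open>vec x \<notin> N\<close> vecU by (auto simp: W_def)
    have "mv J (\<rho> g) (\<lambda>c. \<phi> c (vec x)) = mv J (\<rho> g) x"
      by (rule mv_cong) (simp add: \<phi>_vec)
    then have "\<psi> (g (vec x)) = (\<Sum>i\<in>J. y i * mv J (\<rho> g) x i)"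
      unfolding \<psi>_def using \<rho>[OF lin[OF g(1)] invU[OF g(1)] gN[OF g(1)] vecU] by simp
    then show "\<exists>A\<in>\<rho> ` G. (\<Sum>i\<in>J. y i * mv J A x i) \<noteq> 0" using g by auto
  qed
  \<comment> \<open>Since the action on the quotient is trivial, the coordinates of
    \<open>g u - u\<close> at \<open>J\<close> vanish and only basis vectors of \<open>N\<close>
    remain.\<close>
  have diffN: "g u - u \<in> N" if g: "g \<in> G" and u: "u \<in> U" for g u
  proof -
    have d: "g u - u \<in> U" using that invU U by (intro subspace_diff) auto
    have z: "\<phi> b (g u - u) = 0" if b: "b \<in> J" for b
    proof -
      have "\<phi> b (g u) = mv J (\<rho> g) (\<lambda>c. \<phi> c u) b"
        using \<rho>[OF lin[OF g] invU[OF g] gN[OF g] u b] .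
      also have "\<dots> = (\<Sum>c\<in>J. if b = c then \<phi> c u else 0)"
        unfolding mv_def using b by (intro sum.cong) (auto simp: triv[OF g])
      finally show ?thesis using b J u g invU by (simp add: \<phi>_diff)
    qed
    have "g u - u = (\<Sum>b\<in>BU. scale (\<phi> b (g u - u)) b)" by (rule expand[OF d])
    also have "\<dots> = (\<Sum>b\<in>BN. scale (\<phi> b (g u - u)) b)"
      using z fin BU(1) by (intro sum.mono_neutral_right) (auto simp: J_def)
    also have "\<dots> \<in> N" using N(1) BN(1) by (auto intro!: subspace_sum subspace_scale)
    finally show ?thesis .
  qed
  obtain g u where "g \<in> G" "u \<in> U" "g u \<noteq> u" using RU by (auto simp: R_def)
  with U(2) diffN show ?thesis by (intro bexI[of _ u]) (auto simp: N_def)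
qed

section \<open>A three-dimensional module of the additive group\<close>

definition shear :: "nat \<Rightarrow> 'k \<Rightarrow> 'k::field mat" where
  "shear q a = mat 3 3 (\<lambda>(i, j). if i = j then 1 else if j = 1 then (if i = 0 then a else - (a ^ q)) else 0)"

definition pt :: "'k \<Rightarrow> 'k \<Rightarrow> 'k \<Rightarrow> 'k vec" where
  "pt x y z = vec 3 (\<lambda>i. if i = 0 then x else if i = 1 then y else z)"

lemma less_3_cases: "(i::nat) < 3 \<longleftrightarrow> i = 0 \<or> i = 1 \<or> i = 2"
  by auto

lemma lessThan_3: "{..<3::nat} = {0, 1, 2}" "{0..<3::nat} = {0, 1, 2}"
  by auto

lemma shear_carrier [simp]: "shear q a \<in> carrier_mat 3 3"
  by (simp add: shear_def)

lemma pt_carrier [simp]: "pt x y z \<in> carrier_vec 3"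
  by (simp add: pt_def)

lemma pt_index [simp]: "pt x y z $ 0 = x" "pt x y z $ Suc 0 = y" "pt x y z $ 2 = z"
  by (simp_all add: pt_def)

lemma pt_exhaust: "v \<in> carrier_vec 3 \<Longrightarrow> \<exists>x y z. v = pt x y z"
  by (intro exI[of _ "v $ 0"] exI[of _ "v $ 1"] exI[of _ "v $ 2"] eq_vecI)
     (auto simp: pt_def less_3_cases)

lemma shear_pt: "shear q a *\<^sub>v pt x y z = pt (x + a * y) y (z - a ^ q * y)"
  by (rule eq_vecI)
     (auto simp: pt_def shear_def less_3_cases scalar_prod_def lessThan_3)

lemma shear_mult:
  assumes "(a + b) ^ q = a ^ q + b ^ q"
  shows "shear q a * shear q b = shear q (a + b)"
  by (rule eq_matI)
     (auto simp: shear_def less_3_cases scalar_prod_def lessThan_3 assms)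

lemma shear_0: "q > 0 \<Longrightarrow> shear q 0 = 1\<^sub>m 3"
  by (rule eq_matI) (auto simp: shear_def)

lemma shear_in_GL:
  fixes a :: "'k::field"
  assumes "\<And>a b :: 'k. (a + b) ^ q = a ^ q + b ^ q" "q > 0"
  shows "shear q a \<in> carrier (GL TYPE('k) 3)"
proof -
  have "shear q a * shear q (- a) = 1\<^sub>m 3" "shear q (- a) * shear q a = 1\<^sub>m 3"
    using shear_mult[OF assms(1), of a "- a"] shear_mult[OF assms(1), of "- a" a] assms(2)
    by (simp_all add: shear_0)
  then show ?thesis
    by (auto simp: units_of_def Units_def ring_mat_def intro!: bexI[of _ "shear q (- a)"])
qed

section \<open>Polynomial functions along curves\<close>

lemma poly_eqI_infinite:
  fixes P Q :: "'k::idom poly"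
  assumes "infinite A" "\<And>x. x \<in> A \<Longrightarrow> poly P x = poly Q x"
  shows "P = Q"
proof (rule ccontr)
  assume "P \<noteq> Q"
  then have "finite {x. poly (P - Q) x = 0}" by (intro poly_roots_finite) simp
  moreover have "A \<subseteq> {x. poly (P - Q) x = 0}" using assms by auto
  ultimately show False using assms(1) finite_subset by blast
qed

lemma degree_monom_eval_le:
  fixes W :: "'i \<Rightarrow> 'k::field poly"
  assumes "\<And>i. degree (W i) \<le> 1"
  shows "degree (monom_eval \<alpha> W) \<le> (\<Sum>i\<in>Poly_Mapping.keys \<alpha>. Poly_Mapping.lookup \<alpha> i)"
proof -
  have "degree (monom_eval \<alpha> W) \<le> (\<Sum>i\<in>Poly_Mapping.keys \<alpha>. degree (W i ^ Poly_Mapping.lookup \<alpha> i))"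
    unfolding monom_eval_def
    using degree_prod_sum_le[of "Poly_Mapping.keys \<alpha>" "\<lambda>i. W i ^ Poly_Mapping.lookup \<alpha> i"] by (simp add: comp_def)
  also have "\<dots> \<le> (\<Sum>i\<in>Poly_Mapping.keys \<alpha>. Poly_Mapping.lookup \<alpha> i)"
  proof (rule sum_mono)
    fix i
    have "degree (W i ^ Poly_Mapping.lookup \<alpha> i) \<le> degree (W i) * Poly_Mapping.lookup \<alpha> i"
      by (rule degree_power_le)
    also have "\<dots> \<le> 1 * Poly_Mapping.lookup \<alpha> i" using assms by (rule mult_right_mono) simp
    finally show "degree (W i ^ Poly_Mapping.lookup \<alpha> i) \<le> Poly_Mapping.lookup \<alpha> i" by simp
  qed
  finally show ?thesis .
qed

text \<open>Restriction to a polynomial curve reduces identities between functions to identities in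
  one variable, which may be checked at infinitely many parameters. The substitution is
  \<open>monom_eval\<close> over the polynomial ring itself; along lines it does not raise the
  degree.\<close>

lemma mpoly_eval_poly:
  fixes p :: "('i, 'k::field) mpoly" and W :: "'i \<Rightarrow> 'k poly"
  obtains P where "\<And>t. poly P t = mpoly_eval p (\<lambda>i. poly (W i) t)"
    and "(\<And>i. degree (W i) \<le> 1) \<Longrightarrow> degree P \<le> total_degree p"
proof
  let ?P = "\<Sum>\<alpha>\<in>Poly_Mapping.keys p. smult (Poly_Mapping.lookup p \<alpha>) (monom_eval \<alpha> W)"
  show "poly ?P t = mpoly_eval p (\<lambda>i. poly (W i) t)" for t
    by (simp add: mpoly_eval_def poly_sum monom_eval_def poly_prod)
  assume W: "\<And>i. degree (W i) \<le> 1"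
  show "degree ?P \<le> total_degree p"
  proof (rule degree_sum_le)
    fix \<alpha> assume \<alpha>: "\<alpha> \<in> Poly_Mapping.keys p"
    have "degree (smult (Poly_Mapping.lookup p \<alpha>) (monom_eval \<alpha> W)) \<le> degree (monom_eval \<alpha> W)"
      by (rule degree_smult_le)
    also have "\<dots> \<le> (\<Sum>i\<in>Poly_Mapping.keys \<alpha>. Poly_Mapping.lookup \<alpha> i)"
      by (rule degree_monom_eval_le[OF W])
    also have "\<dots> \<le> total_degree p"
      unfolding total_degree_def by (rule Max_ge) (use \<alpha> in auto)
    finally show "degree (smult (Poly_Mapping.lookup p \<alpha>) (monom_eval \<alpha> W)) \<le> total_degree p" .
  qed simp
qed

lemma poly_fun_pt_poly:
  fixes p :: "(nat, 'k::field) mpoly"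
  assumes "p \<in> polys_in {..<3}"
  obtains P where "\<And>t. poly P t = poly_fun 3 p (pt (poly X t) (poly Y t) (poly Z t))"
    and "degree X \<le> 1 \<Longrightarrow> degree Y \<le> 1 \<Longrightarrow> degree Z \<le> 1 \<Longrightarrow> degree P \<le> total_degree p"
proof -
  \<comment> \<open>All indices from 2 on receive \<open>Z\<close>, which keeps every
    \<open>degree (W i)\<close> at most 1 in the case of lines; among them \<open>p\<close> sees
    only index 2.\<close>
  define W where "W = (\<lambda>i::nat. if i = 0 then X else if i = 1 then Y else Z)"
  obtain P where P: "\<And>t. poly P t = mpoly_eval p (\<lambda>i. poly (W i) t)"
    and d: "(\<And>i. degree (W i) \<le> 1) \<Longrightarrow> degree P \<le> total_degree p"
    using mpoly_eval_poly[of p W] by blast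
  have "poly_fun 3 p (pt (poly X t) (poly Y t) (poly Z t)) = mpoly_eval p (\<lambda>i. poly (W i) t)" for t
  proof -
    have "pt (poly X t) (poly Y t) (poly Z t) $ i = poly (W i) t" if "i < 3" for i
      using that by (auto simp: W_def less_3_cases)
    then have "monom_eval \<alpha> (\<lambda>i. pt (poly X t) (poly Y t) (poly Z t) $ i) = monom_eval \<alpha> (\<lambda>i. poly (W i) t)"
      if "\<alpha> \<in> Poly_Mapping.keys p" for \<alpha>
      using assms that unfolding monom_eval_def polys_in_def by (intro prod.cong) force+
    then show ?thesis by (simp add: poly_fun_def mpoly_eval_def)
  qed
  with P d show thesis by (intro that[of P]) (auto simp: W_def)
qed

text \<open>\<open>K\<close> will be the set of values of the additive character and
  \<open>f\<close> an invariant of the module. The curve arguments thus take place without reference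
  to the group.\<close>

locale shear_invariant =
  fixes p :: "(nat, 'k::alg_closed_field) mpoly" and f and q :: nat and K :: "'k set"
  assumes p: "p \<in> polys_in {..<3}" and f: "f = poly_fun 3 p"
    and K: "infinite K" and q: "q \<ge> 2"
    and inv_K: "\<And>a x y z. a \<in> K \<Longrightarrow> f (pt (x + a * y) y (z - a ^ q * y)) = f (pt x y z)"
begin

text \<open>For fixed \<open>x\<close>, \<open>y\<close>, \<open>z\<close> the left side is a
  polynomial in \<open>a\<close> that is constant on the infinite set \<open>K\<close>, hence
  constant.\<close>

lemma inv: "f (pt (x + a * y) y (z - a ^ q * y)) = f (pt x y z)"
proof -
  \<comment> \<open>The third coordinate is a form of \<open>z - t^q * y\<close> valid for nonzero
    \<open>y\<close>; for \<open>y = 0\<close> the claim is trivial.\<close>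
  obtain P where P: "\<And>t. poly P t = f (pt (poly [:x, y:] t) (poly [:y:] t) (poly (smult y ([:z / y:] - monom 1 q)) t))"
    using poly_fun_pt_poly[OF p] unfolding f by metis
  show ?thesis
  proof (cases "y = 0")
    case False
    have P': "poly P t = f (pt (x + t * y) y (z - t ^ q * y))" for t
      using False unfolding P by (simp add: poly_monom algebra_simps)
    have "P = [:f (pt x y z):]"
      by (rule poly_eqI_infinite[OF K]) (simp add: P' inv_K)
    with P'[of a] show ?thesis by simp
  qed simp
qed

text \<open>The choice \<open>a = - s / y\<close> clears the first coordinate.\<close>

lemma move_to_x_0: "y \<noteq> 0 \<Longrightarrow> f (pt s y 0) = f (pt 0 y (- ((- s / y) ^ q * y)))"
  using inv[of s "- s / y" y 0] by simp

lemma infinite_nonzero: "infinite (UNIV - {0::'k})"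
  using K finite_subset[of K UNIV] by auto

text \<open>Let \<open>w^q = - z\<close>. For \<open>t \<noteq> 0\<close> the parameter
  \<open>a = w / t\<close> carries \<open>(- w t^(q-1), t^q, 0)\<close> to
  \<open>(0, t^q, z)\<close>, so \<open>f\<close> agrees along the two curves. At
  \<open>t = 0\<close> they reach the origin and \<open>(0, 0, z)\<close>.\<close>

lemma const_z: "f (pt 0 0 z) = f (pt 0 0 0)"
proof -
  obtain w where w: "w ^ q = - z" using nth_root_exists[of q "- z"] q by auto
  obtain P where P: "\<And>t. poly P t = f (pt (poly (monom (- w) (q - 1)) t) (poly (monom 1 q) t) (poly 0 t))"
    using poly_fun_pt_poly[OF p] unfolding f by metis
  obtain Q where Q: "\<And>t. poly Q t = f (pt (poly 0 t) (poly (monom 1 q) t) (poly [:z:] t))"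
    using poly_fun_pt_poly[OF p] unfolding f by metis
  have "P = Q"
  proof (rule poly_eqI_infinite[OF infinite_nonzero])
    fix t :: 'k assume t: "t \<in> UNIV - {0}"
    have "t ^ q = t * t ^ (q - 1)" using q by (simp flip: power_Suc)
    then have "- (- w * t ^ (q - 1)) / t ^ q = w / t" using t by (simp add: field_simps)
    then have "- ((- (- w * t ^ (q - 1)) / t ^ q) ^ q * t ^ q) = z"
      using t by (simp only:) (simp add: power_divide w)
    then show "poly P t = poly Q t"
      using move_to_x_0[of "t ^ q" "- w * t ^ (q - 1)"] t by (simp add: P Q poly_monom)
  qed
  \<comment> \<open>Positivity of both exponents, from \<open>q \<ge> 2\<close>, makes the monomials
    vanish at \<open>t = 0\<close>.\<close>
  moreover have "q \<noteq> 0" "q - 1 \<noteq> 0" using q by auto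
  ultimately show ?thesis using P[of 0] Q[of 0] by (simp add: poly_monom power_0_left)
qed

lemma const_x:
  assumes "total_degree p < q"
  shows "f (pt 1 0 0) = f (pt 0 0 0)"
proof -
  have y: "f (pt 1 y 0) = f (pt 0 y 0)" if "y \<noteq> 0" for y
  proof -
    obtain A where A: "\<And>t. poly A t = f (pt (poly [:0, 1:] t) (poly [:y:] t) (poly 0 t))"
      "degree A \<le> total_degree p"
      using poly_fun_pt_poly[OF p, of "[:0, 1:]" "[:y:]" 0] unfolding f by auto
    obtain B where B: "\<And>t. poly B t = f (pt (poly 0 t) (poly [:y:] t) (poly [:0, 1:] t))"
      using poly_fun_pt_poly[OF p] unfolding f by metis
    define c where "c = - ((- 1 / y) ^ q * y)"
    have c: "c \<noteq> 0" using that by (simp add: c_def)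
    \<comment> \<open>Moving to \<open>x = 0\<close> reads \<open>A t = B (c * t^q)\<close>, so the
      degree of \<open>A\<close> is a multiple of \<open>q\<close>; being at most
      \<open>total_degree p < q\<close>, it is zero.\<close>
    have "A = pcompose B (monom c q)"
    proof (rule poly_eqI_infinite[OF infinite_nonzero])
      fix t
      have "(- t / y) ^ q = (- 1 / y) ^ q * t ^ q"
        by (simp flip: power_mult_distrib)
      then show "poly A t = poly (pcompose B (monom c q)) t"
        using move_to_x_0[OF that, of t] by (simp add: A B poly_pcompose poly_monom c_def mult_ac)
    qed
    then have "degree A = degree B * q" using c by (simp add: degree_pcompose degree_monom_eq)
    moreover have "degree B = 0"
    proof (rule ccontr)
      assume "degree B \<noteq> 0"
      then have "1 * q \<le> degree B * q" by (intro mult_le_mono1) simp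
      with A(2) assms \<open>degree A = degree B * q\<close> show False by simp
    qed
    ultimately have "degree A = 0" by simp
    then obtain e where "A = [:e:]" by (rule degree_eq_zeroE)
    with A(1)[of 1] A(1)[of 0] show ?thesis by simp
  qed
  \<comment> \<open>The equality for \<open>y \<noteq> 0\<close> is an identity of polynomials in
    \<open>y\<close>, so it persists at \<open>y = 0\<close>.\<close>
  obtain P where P: "\<And>t. poly P t = f (pt (poly 1 t) (poly [:0, 1:] t) (poly 0 t))"
    using poly_fun_pt_poly[OF p] unfolding f by metis
  obtain Q where Q: "\<And>t. poly Q t = f (pt (poly 0 t) (poly [:0, 1:] t) (poly 0 t))"
    using poly_fun_pt_poly[OF p] unfolding f by metis
  have "P = Q"
    by (rule poly_eqI_infinite[OF infinite_nonzero]) (simp add: P Q y)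
  with P[of 0] Q[of 0] show ?thesis by simp
qed

end

section \<open>Additive characters of unipotent groups\<close>

lemma polys_in_add: "p \<in> polys_in I \<Longrightarrow> q \<in> polys_in I \<Longrightarrow> p + q \<in> polys_in I"
  unfolding polys_in_def by (auto dest!: subsetD[OF keys_add])

lemma polys_in_uminus: "p \<in> polys_in I \<Longrightarrow> - p \<in> polys_in I" for p :: "('i, 'k::ring_1) mpoly"
  by (simp add: polys_in_def in_keys_iff)

lemma polys_in_diff: "p \<in> polys_in I \<Longrightarrow> q \<in> polys_in I \<Longrightarrow> p - q \<in> polys_in I"
  for p :: "('i, 'k::ring_1) mpoly"
  using polys_in_add[OF _ polys_in_uminus, of p I q] by simp

lemma zero_in_polys_in [simp]: "0 \<in> polys_in I"
  by (simp add: polys_in_def)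

lemma polys_in_sum: "(\<And>j. j \<in> J \<Longrightarrow> p j \<in> polys_in I) \<Longrightarrow> (\<Sum>j\<in>J. p j) \<in> polys_in I"
  by (induction J rule: infinite_finite_induct) (auto intro: polys_in_add)

lemma polys_in_prod: "(\<And>j. j \<in> J \<Longrightarrow> p j \<in> polys_in I) \<Longrightarrow> (\<Prod>j\<in>J. p j) \<in> polys_in I"
  for p :: "'j \<Rightarrow> ('i, 'k::comm_ring_1) mpoly"
  by (induction J rule: infinite_finite_induct) (auto intro: polys_in_mult)

lemma polys_in_power: "p \<in> polys_in I \<Longrightarrow> p ^ k \<in> polys_in I"
  for p :: "('i, 'k::comm_ring_1) mpoly"
  by (induction k) (auto intro: polys_in_mult)

lemma polys_in_single: "Poly_Mapping.keys \<alpha> \<subseteq> I \<Longrightarrow> Poly_Mapping.single \<alpha> c \<in> polys_in I"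
  by (simp add: polys_in_def)

lemma mpoly_eval_uminus: "mpoly_eval (- p) x = - mpoly_eval p x" for p :: "('i, 'k::comm_ring_1) mpoly"
  using mpoly_eval_add[of p "- p" x] by (simp add: add_eq_0_iff2)

lemma mpoly_eval_diff: "mpoly_eval (p - q) x = mpoly_eval p x - mpoly_eval q x"
  for p :: "('i, 'k::comm_ring_1) mpoly"
  using mpoly_eval_add[of p "- q" x] by (simp add: mpoly_eval_uminus)

lemma mpoly_eval_prod: "mpoly_eval (\<Prod>j\<in>J. p j) x = (\<Prod>j\<in>J. mpoly_eval (p j) x)"
  for p :: "'j \<Rightarrow> ('i, 'k::comm_ring_1) mpoly"
  by (induction J rule: infinite_finite_induct) (simp_all add: mpoly_eval_mult)

lemma mpoly_eval_power: "mpoly_eval (p ^ k) x = mpoly_eval p x ^ k"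
  for p :: "('i, 'k::comm_ring_1) mpoly"
  by (induction k) (simp_all add: mpoly_eval_mult)

lemma monom_eval_0 [simp]: "monom_eval 0 x = 1"
  by (simp add: monom_eval_def)

lemma monom_eval_single [simp]: "monom_eval (Poly_Mapping.single i k) x = x i ^ k"
  by (simp add: monom_eval_def)

lemma GL_simps:
  "carrier (GL TYPE('k::field) n) \<subseteq> carrier_mat n n"
  "g \<otimes>\<^bsub>GL TYPE('k) n\<^esub> h = g * h"
  "\<one>\<^bsub>GL TYPE('k) n\<^esub> = 1\<^sub>m n"
  by (auto simp: units_of_def Units_def ring_mat_def)

text \<open>If all \<open>g u - u\<close> are fixed vectors, then
  \<open>g h u - u = g (h u - u) + (g u - u)\<close> shows that \<open>g u - u\<close> is additive
  in \<open>g\<close>. A coordinate of it that is not identically zero is the character, and it is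
  affine in the matrix entries.\<close>

lemma unipotent_group_additive_character:
  fixes G :: "'k::alg_closed_field mat set"
  assumes G: "subgroup G (GL TYPE('k) n)" and "infinite G" and unip: "unipotent_group n G"
  shows "\<exists>c\<in>mat_polys n. (\<exists>g\<in>G. mat_eval c g \<noteq> 0) \<and>
    (\<forall>g\<in>G. \<forall>h\<in>G. mat_eval c (g * h) = mat_eval c g + mat_eval c h)"
proof -
  define scl where "scl = (\<lambda>(c::'k) (x::nat \<Rightarrow> 'k) i. c * x i)"
  interpret vector_space scl
    by unfold_locales (auto simp: scl_def algebra_simps fun_eq_iff)
  \<comment> \<open>Vectors are functions on all naturals, and \<open>act\<close> is the identity
    beyond \<open>n\<close>. This makes \<open>act g\<close> linear on the whole function space and
    lets \<open>1\<^sub>m n\<close> act as the identity.\<close>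
  define act where "act = (\<lambda>(g::'k mat) (x::nat \<Rightarrow> 'k) i. if i < n then \<Sum>j<n. g $$ (i, j) * x j else x i)"
  define V where "V = {x::nat \<Rightarrow> 'k. \<forall>i\<ge>n. x i = 0}"
  define F where "F = (\<lambda>j i. if i = j then 1 else 0 :: 'k) ` {..<n}"
  have Gc: "g \<in> carrier_mat n n" if "g \<in> G" for g
    using subgroup.subset[OF G] GL_simps(1) that by blast
  have Gm: "g * h \<in> G" if "g \<in> G" "h \<in> G" for g h
    using subgroup.m_closed[OF G that] by (simp add: GL_simps)
  have G1: "1\<^sub>m n \<in> G" using subgroup.one_closed[OF G] by (simp add: GL_simps)
  have act_mult: "act (g * h) x = act g (act h x)" if "g \<in> G" "h \<in> G" for g h x
  proof
    fix i
    show "act (g * h) x i = act g (act h x) i"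
    proof (cases "i < n")
      case True
      have "(\<Sum>j<n. (g * h) $$ (i, j) * x j) = (\<Sum>j<n. \<Sum>l<n. g $$ (i, l) * h $$ (l, j) * x j)"
        using Gc[OF that(1)] Gc[OF that(2)] True
        by (intro sum.cong) (auto simp: scalar_prod_def sum_distrib_right atLeast0LessThan)
      also have "\<dots> = (\<Sum>l<n. g $$ (i, l) * (\<Sum>j<n. h $$ (l, j) * x j))"
        by (subst sum.swap) (simp add: sum_distrib_left mult.assoc)
      finally show ?thesis using True by (simp add: act_def)
    qed (simp add: act_def)
  qed
  have act_1: "act (1\<^sub>m n) x = x" for x
    by (auto simp: act_def fun_eq_iff if_distrib[of "\<lambda>c. c * _"] cong: if_cong)
  have act_diff: "act g x i - x i = (if i < n then \<Sum>j<n. (g - 1\<^sub>m n) $$ (i, j) * x j else 0)"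
    if "g \<in> G" for g x i
  proof -
    have "(\<Sum>j<n. (g - 1\<^sub>m n) $$ (i, j) * x j) = (\<Sum>j<n. g $$ (i, j) * x j) - (\<Sum>j<n. if i = j then x j else 0)"
      if "i < n"
      unfolding sum_subtractf[symmetric] using Gc[OF \<open>g \<in> G\<close>] that
      by (intro sum.cong) (auto simp: left_diff_distrib)
    then show ?thesis by (simp add: act_def)
  qed
  have "\<exists>u\<in>V. (\<exists>g\<in>act ` G. g u \<noteq> u) \<and> (\<forall>g\<in>act ` G. \<forall>h\<in>act ` G. h (g u - u) = g u - u)"
  proof (rule unipotent_action_fixed_differences)
    show "vector_space scl" by unfold_locales
    show "module.subspace scl V" by (rule subspaceI) (auto simp: V_def scl_def)
    show "finite F" by (simp add: F_def)
    show "V \<subseteq> module.span scl F"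
    proof
      fix x assume x: "x \<in> V"
      have "x = (\<Sum>j<n. scl (x j) (\<lambda>i. if i = j then 1 else 0))"
      proof
        fix i
        have "(\<Sum>j<n. scl (x j) (\<lambda>i. if i = j then 1 else 0)) i = (\<Sum>j<n. if i = j then x j else 0)"
          by (induction n) (auto simp: scl_def)
        also have "\<dots> = x i" using x by (auto simp: V_def)
        finally show "x i = (\<Sum>j<n. scl (x j) (\<lambda>i. if i = j then 1 else 0)) i" by simp
      qed
      also have "\<dots> \<in> span F"
        by (intro span_sum span_scale span_base) (auto simp: F_def)
      finally show "x \<in> span F" .
    qed
    show "Vector_Spaces.linear scl scl g" if "g \<in> act ` G" for g
      using that vector_space_axioms unfolding Vector_Spaces.linear_iff
      by (auto simp: act_def scl_def fun_eq_iff distrib_left sum.distrib sum_distrib_left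
          mult.left_commute)
    show "g v \<in> V" if "g \<in> act ` G" "v \<in> V" for g v
      using that by (auto simp: act_def V_def)
    show "(\<lambda>v. v) \<in> act ` G" 
    proof -
      have "act (1\<^sub>m n) = (\<lambda>v. v)" by (rule ext) (rule act_1)
      then show ?thesis using G1 by (metis image_eqI)
    qed
    show "(\<lambda>v. g (h v)) \<in> act ` G" if "g \<in> act ` G" "h \<in> act ` G" for g h
    proof -
      obtain a b where ab: "a \<in> G" "b \<in> G" "g = act a" "h = act b"
        using \<open>g \<in> act ` G\<close> \<open>h \<in> act ` G\<close> by blast
      then have "(\<lambda>v. g (h v)) = act (a * b)" by (intro ext) (simp add: act_mult)
      then show ?thesis using Gm ab by blast
    qed
    show "\<exists>r. \<forall>v\<in>V. ((\<lambda>v. g v - v) ^^ r) v = 0" if "g \<in> act ` G" for g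
    proof -
      obtain a where a: "a \<in> G" "g = act a" using \<open>g \<in> act ` G\<close> by blast
      define D where "D = a - 1\<^sub>m n"
      have D: "D \<in> carrier_mat n n" using Gc[OF a(1)] by (simp add: D_def minus_carrier_mat)
      obtain r where r: "D ^\<^sub>m r = 0\<^sub>m n n"
        using unip a by (auto simp: unipotent_group_def D_def)
      \<comment> \<open>On \<open>V\<close> the iterates of \<open>g - 1\<close> are the powers of
        \<open>D\<close>; membership in \<open>V\<close> settles the entries beyond \<open>n\<close>
        at \<open>k = 0\<close>.\<close>
      have iter: "((\<lambda>v. g v - v) ^^ k) v = (\<lambda>i. if i < n then \<Sum>j<n. (D ^\<^sub>m k) $$ (i, j) * v j else 0)"
        if "v \<in> V" for v k
        using that
      proof (induction k arbitrary: v)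
        case 0
        then show ?case using D
          by (auto simp: V_def fun_eq_iff if_distrib[of "\<lambda>c. c * _"] cong: if_cong)
      next
        case (Suc k)
        have gv: "g v - v = (\<lambda>i. if i < n then \<Sum>j<n. D $$ (i, j) * v j else 0)"
          using act_diff[OF a(1)] by (simp add: a fun_eq_iff D_def)
        have Dk: "D ^\<^sub>m k \<in> carrier_mat n n" using D by simp
        have "((\<lambda>v. g v - v) ^^ Suc k) v = ((\<lambda>v. g v - v) ^^ k) (g v - v)"
          by (simp only: funpow_Suc_right comp_apply)
        also have "\<dots> = (\<lambda>i. if i < n then \<Sum>l<n. (D ^\<^sub>m k) $$ (i, l) * (g v - v) l else 0)"
          by (rule Suc.IH) (simp add: V_def gv)
        also have "\<dots> = (\<lambda>i. if i < n then \<Sum>j<n. (D ^\<^sub>m Suc k) $$ (i, j) * v j else 0)"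
        proof
          fix i
          have "(\<Sum>l<n. (D ^\<^sub>m k) $$ (i, l) * (g v - v) l) = (\<Sum>j<n. (D ^\<^sub>m Suc k) $$ (i, j) * v j)" if "i < n"
          proof -
            have "(\<Sum>l<n. (D ^\<^sub>m k) $$ (i, l) * (g v - v) l)
                = (\<Sum>l<n. \<Sum>j<n. (D ^\<^sub>m k) $$ (i, l) * (D $$ (l, j) * v j))"
              by (simp add: gv sum_distrib_left)
            also have "\<dots> = (\<Sum>j<n. \<Sum>l<n. (D ^\<^sub>m k) $$ (i, l) * (D $$ (l, j) * v j))"
              by (rule sum.swap)
            also have "\<dots> = (\<Sum>j<n. (D ^\<^sub>m Suc k) $$ (i, j) * v j)"
              using D Dk that by (intro sum.cong)
                (auto simp: scalar_prod_def sum_distrib_right atLeast0LessThan mult.assoc)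
            finally show ?thesis .
          qed
          then show "(if i < n then \<Sum>l<n. (D ^\<^sub>m k) $$ (i, l) * (g v - v) l else 0) =
              (if i < n then \<Sum>j<n. (D ^\<^sub>m Suc k) $$ (i, j) * v j else 0)" by simp
        qed
        finally show ?case .
      qed
      have "((\<lambda>v. g v - v) ^^ r) v = 0" if "v \<in> V" for v
        unfolding iter[OF that] r by (auto simp: fun_eq_iff)
      then show ?thesis by blast
    qed
    \<comment> \<open>Tested on unit vectors, a trivial action would leave only the identity in
      \<open>G\<close>, against infinitude.\<close>
    show "\<exists>g\<in>act ` G. \<exists>v\<in>V. g v \<noteq> v"
    proof (rule ccontr)
      assume "\<not> ?thesis"
      then have triv: "act g v = v" if "g \<in> G" "v \<in> V" for g v using that by blast
      have "g = 1\<^sub>m n" if g: "g \<in> G" for g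
      proof (rule eq_matI)
        fix i j assume ij: "i < dim_row (1\<^sub>m n)" "j < dim_col (1\<^sub>m n)"
        define e where "e = (\<lambda>i. if i = j then 1 else 0 :: 'k)"
        have "act g e = e" using triv[OF g, of e] ij by (simp add: e_def V_def)
        then have "act g e i = e i" by simp
        moreover have "act g e i = (\<Sum>l<n. if l = j then g $$ (i, l) else 0)"
          using ij by (simp add: act_def e_def if_distrib[of "\<lambda>c. _ * c"] cong: if_cong)
        ultimately show "g $$ (i, j) = 1\<^sub>m n $$ (i, j)" using ij by (simp add: e_def)
      qed (use Gc[OF g] in auto)
      then have "G \<subseteq> {1\<^sub>m n}" by blast
      with \<open>infinite G\<close> show False using finite_subset by blast
    qed
  qed
  then obtain u where nt: "\<exists>g\<in>G. act g u \<noteq> u"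
    and fixd: "\<And>g h. g \<in> G \<Longrightarrow> h \<in> G \<Longrightarrow> act h (act g u - u) = act g u - u"
    by blast
  then obtain g0 i where g0: "g0 \<in> G" "act g0 u i \<noteq> u i" by (auto simp: fun_eq_iff)
  then have i: "i < n" by (auto simp: act_def split: if_splits)
  \<comment> \<open>\<open>c\<close> is coordinate \<open>i\<close> of \<open>g u - u\<close>,
    written as an affine polynomial in row \<open>i\<close> of \<open>g\<close>.\<close>
  define c :: "(nat \<times> nat, 'k) mpoly" where
    "c = (\<Sum>j<n. Poly_Mapping.single (Poly_Mapping.single (i, j) 1) (u j)) - Poly_Mapping.single 0 (u i)"
  have c: "c \<in> mat_polys n"
    unfolding c_def using i by (intro polys_in_diff polys_in_sum polys_in_single) auto
  have eval_c: "mat_eval c g = act g u i - u i" for g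
    using i by (simp add: c_def mpoly_eval_diff mpoly_eval_sum act_def mult.commute)
  have "mat_eval c (g * h) = mat_eval c g + mat_eval c h" if "g \<in> G" "h \<in> G" for g h
  proof -
    have "act g (act h u - u) i = act g (act h u) i - act g u i"
      using i by (simp add: act_def right_diff_distrib sum_subtractf)
    then show ?thesis using fun_cong[OF fixd[OF that(2,1)], of i] by (simp add: eval_c act_mult[OF that])
  qed
  moreover have "mat_eval c g0 \<noteq> 0" using g0 by (simp add: eval_c)
  ultimately show ?thesis using c g0(1) by blast
qed

text \<open>Finitely many values would split \<open>G\<close> into two nonempty disjoint relatively
  closed pieces: the fibre of the value at \<open>g0\<close>, and the union of the other fibres,
  which is the zero set of a finite product.\<close>

lemma connected_group_infinite_image:
  fixes G :: "'k::field mat set"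
  assumes G: "subgroup G (GL TYPE('k) n)" and conn: "connected_group n G"
    and c: "c \<in> mat_polys n"
    and vals: "g0 \<in> G" "g1 \<in> G" "mat_eval c g0 \<noteq> mat_eval c g1"
  shows "infinite ((\<lambda>g. mat_eval c g) ` G)"
proof
  assume fin: "finite ((\<lambda>g. mat_eval c g) ` G)"
  define d where "d = (\<lambda>a. c - Poly_Mapping.single 0 a)"
  have d: "d a \<in> mat_polys n" "mat_eval (d a) g = mat_eval c g - a" for a g
    using c by (auto simp: d_def mpoly_eval_diff intro!: polys_in_diff polys_in_single)
  define A where "A = (\<lambda>g. mat_eval c g) ` G - {mat_eval c g0}"
  define E1 where "E1 = GL_vanishing_set n {d (mat_eval c g0)}"
  define E2 where "E2 = GL_vanishing_set n {\<Prod>a\<in>A. d a}"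
  have finA: "finite A" using fin by (simp add: A_def)
  have sub: "G \<subseteq> carrier (GL TYPE('k) n)" by (rule subgroup.subset[OF G])
  have closed: "closedin (zariski_GL n) (GL_vanishing_set n {r})" if "r \<in> mat_polys n"
    for r :: "(nat \<times> nat, 'k) mpoly"
    unfolding closedin_zariski_GL using that by (intro exI[of _ "{r}"]) simp
  have E: "closedin (zariski_GL n) E1" "closedin (zariski_GL n) E2"
    unfolding E1_def E2_def using d(1) by (auto intro!: closed polys_in_prod)
  have mem: "g \<in> E1 \<longleftrightarrow> mat_eval c g = mat_eval c g0" "g \<in> E2 \<longleftrightarrow> mat_eval c g \<noteq> mat_eval c g0"
    if "g \<in> G" for g
    using that sub finA by (auto simp: E1_def E2_def GL_vanishing_set_def d(2) mpoly_eval_prod A_def)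
  have "G \<subseteq> E1 \<union> E2" "E1 \<inter> E2 \<inter> G = {}" using mem by auto
  moreover have "g0 \<in> E1 \<inter> G" "g1 \<in> E2 \<inter> G" using mem vals by auto
  ultimately show False
    using conn E unfolding connected_group_def connectedin_closedin by (metis empty_iff)
qed

section \<open>Unboundedness\<close>

lemma total_degree_le:
  assumes "\<And>\<alpha>. \<alpha> \<in> Poly_Mapping.keys p \<Longrightarrow>
    (\<Sum>i\<in>Poly_Mapping.keys \<alpha>. Poly_Mapping.lookup \<alpha> i) \<le> d"
  shows "total_degree p \<le> d"
  unfolding total_degree_def using assms by (intro Max.boundedI) auto

text \<open>Fixed points have \<open>y = 0\<close>. Those with \<open>x = 0\<close> lie in the
  nullcone by \<open>const_z\<close>, and the others are detected by \<open>x^q + y^(q-1) z\<close>,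
  of degree \<open>q\<close>. In smaller degree the point \<open>(1, 0, 0)\<close> is missed, by
  \<open>const_x\<close>.\<close>

lemma delta_module_shear:
  fixes G :: "'k::alg_closed_field mat set"
  assumes G: "subgroup G (GL TYPE('k) n)"
    and c: "c \<in> mat_polys n"
    and hom: "\<And>g h. g \<in> G \<Longrightarrow> h \<in> G \<Longrightarrow> mat_eval c (g * h) = mat_eval c g + mat_eval c h"
    and inf: "infinite ((\<lambda>g. mat_eval c g) ` G)"
    and q: "q \<ge> 2" and frob: "\<And>a b :: 'k. (a + b) ^ q = a ^ q + b ^ q"
  defines "\<rho> \<equiv> \<lambda>g. shear q (mat_eval c g)"
  shows "G_module n G 3 \<rho>" and "delta_module n G 3 \<rho> = q"
proof -
  show "G_module n G 3 \<rho>"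
    unfolding G_module_def
  proof (intro conjI allI impI)
    show "\<rho> \<in> hom (GL TYPE('k) n\<lparr>carrier := G\<rparr>) (GL TYPE('k) 3)"
      using shear_in_GL[OF frob] q frob
      by (auto simp: hom_def GL_simps \<rho>_def hom shear_mult)
    fix i j :: nat assume ij: "i < 3" "j < 3"
    \<comment> \<open>The entries of \<open>\<rho> g\<close> are polynomials in those of
      \<open>g\<close>, so the determinant occurs with exponent 0.\<close>
    define e where "e = (if i = j then 1 else if j = 1 then (if i = 0 then c else - (c ^ q)) else 0)"
    have "e \<in> mat_polys n"
      using c by (auto simp: e_def polys_in_power intro!: polys_in_uminus)
    moreover have "\<rho> g $$ (i, j) = mat_eval e g" for g
      using ij by (simp add: \<rho>_def shear_def e_def mpoly_eval_uminus mpoly_eval_power)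
    ultimately show "(\<lambda>g. \<rho> g $$ (i, j)) \<in> regular_functions n G"
      unfolding regular_functions_def by (auto intro!: bexI[of _ e] exI[of _ 0])
  qed
  define K where "K = (\<lambda>g. mat_eval c g) ` G"
  have inv_G: "inv\<^bsub>GL TYPE('k) n\<^esub> g \<in> G" if "g \<in> G" for g
    by (rule subgroup.m_inv_closed[OF G that])
  have inv_inv: "inv\<^bsub>GL TYPE('k) n\<^esub> (inv\<^bsub>GL TYPE('k) n\<^esub> g) = g" if "g \<in> G" for g
    using group.inv_inv[OF group_GL] subgroup.subset[OF G] that by blast
  \<comment> \<open>The action on functions involves inverses; as \<open>G\<close> is closed under
    them, invariance can be tested with the values \<open>a\<close> themselves.\<close>
  have invariant_iff: "f \<in> invariant_ring n G 3 \<rho> \<longleftrightarrow> f \<in> coord_ring 3 \<and>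
      (\<forall>a\<in>K. \<forall>x y z. f (pt (x + a * y) y (z - a ^ q * y)) = f (pt x y z))" (is "_ \<longleftrightarrow> ?R") for f
  proof
    assume f: "f \<in> invariant_ring n G 3 \<rho>"
    have "f (pt (x + a * y) y (z - a ^ q * y)) = f (pt x y z)" if "a \<in> K" for a x y z
    proof -
      obtain g where g: "g \<in> G" "a = mat_eval c g" using \<open>a \<in> K\<close> by (auto simp: K_def)
      have "act_fun n 3 \<rho> (inv\<^bsub>GL TYPE('k) n\<^esub> g) f (pt x y z) = f (pt x y z)"
        using f inv_G[OF g(1)] by (simp add: invariant_ring_def)
      then show ?thesis by (simp add: act_fun_def inv_inv[OF g(1)] \<rho>_def shear_pt g(2))
    qed
    then show ?R using f by (simp add: invariant_ring_def)
  next
    assume R: ?R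
    have "act_fun n 3 \<rho> g f = f" if "g \<in> G" for g
    proof
      fix v
      show "act_fun n 3 \<rho> g f v = f v"
      proof (cases "v \<in> carrier_vec 3")
        case True
        then obtain x y z where v: "v = pt x y z" using pt_exhaust by blast
        have "mat_eval c (inv\<^bsub>GL TYPE('k) n\<^esub> g) \<in> K" using inv_G[OF that] by (simp add: K_def)
        with R show ?thesis by (simp add: act_fun_def \<rho>_def v shear_pt)
      next
        case False
        then show ?thesis using R by (auto simp: act_fun_def coord_ring_def poly_fun_def)
      qed
    qed
    then show "f \<in> invariant_ring n G 3 \<rho>" using R by (simp add: invariant_ring_def)
  qed
  have zero_pt: "0\<^sub>v 3 = pt 0 0 (0::'k)"
    by (rule eq_vecI) (auto simp: pt_def)
  have shear_inv: "shear_invariant p (poly_fun 3 p) q K"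
    if "p \<in> polys_in {..<3}" "poly_fun 3 p \<in> invariant_ring n G 3 \<rho>" for p
    using that inf q by (unfold_locales) (auto simp: invariant_iff K_def)
  define p0 :: "(nat, 'k) mpoly" where
    "p0 = Poly_Mapping.single (Poly_Mapping.single 0 q) 1 +
      Poly_Mapping.single (Poly_Mapping.single 1 (q - 1) + Poly_Mapping.single 2 1) 1"
  have p0: "p0 \<in> polys_in {..<3}"
    unfolding p0_def by (intro polys_in_add polys_in_single order.trans[OF keys_add]) auto
  have f0: "poly_fun 3 p0 (pt x y z) = x ^ q + y ^ (q - 1) * z" for x y z
    by (simp add: poly_fun_def p0_def mpoly_eval_add monom_eval_add)
  have deg0: "total_degree p0 \<le> q"
  proof (rule total_degree_le)
    let ?\<beta> = "Poly_Mapping.single 1 (q - 1) + Poly_Mapping.single 2 1 :: nat \<Rightarrow>\<^sub>0 nat"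
    fix \<alpha> assume "\<alpha> \<in> Poly_Mapping.keys p0"
    then have "\<alpha> = Poly_Mapping.single 0 q \<or> \<alpha> = ?\<beta>"
      unfolding p0_def by (auto dest!: subsetD[OF keys_add])
    moreover have "(\<Sum>i\<in>Poly_Mapping.keys ?\<beta>. Poly_Mapping.lookup ?\<beta> i) \<le> (\<Sum>i\<in>{1, 2}. Poly_Mapping.lookup ?\<beta> i)"
      by (rule sum_mono2) (auto dest!: subsetD[OF keys_add] split: if_splits)
    moreover have "(\<Sum>i\<in>{1, 2}. Poly_Mapping.lookup ?\<beta> i) = q"
      using q by (simp add: lookup_add lookup_single)
    ultimately show "(\<Sum>i\<in>Poly_Mapping.keys \<alpha>. Poly_Mapping.lookup \<alpha> i) \<le> q"
      by auto
  qed
  have yq: "y * y ^ (q - 1) = y ^ q" for y :: 'k using q by (simp flip: power_Suc)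
  have inv0: "poly_fun 3 p0 \<in> invariant_ring n G 3 \<rho>"
    unfolding invariant_iff
  proof (intro conjI ballI allI)
    show "poly_fun 3 p0 \<in> coord_ring 3" using p0 by (simp add: coord_ring_def)
    fix a x y z :: 'k
    \<comment> \<open>The gain of \<open>x^q\<close> and the loss of \<open>y^(q-1) z\<close> are
      both \<open>(a y)^q\<close>.\<close>
    have "y ^ (q - 1) * (a ^ q * y) = (a * y) ^ q"
      using yq[of y] by (simp add: power_mult_distrib mult_ac)
    then show "poly_fun 3 p0 (pt (x + a * y) y (z - a ^ q * y)) = poly_fun 3 p0 (pt x y z)"
      by (simp add: f0 frob right_diff_distrib)
  qed
  have null0: "v \<notin> nullcone n G 3 \<rho>" if "poly_fun 3 p0 v \<noteq> 0" for v
    using that inv0 q by (auto simp: nullcone_def plus_part_def zero_pt f0)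
  show "delta_module n G 3 \<rho> = q"
    unfolding delta_module_def
  proof (rule Least_equality)
    have "\<exists>f\<in>plus_part 3 (invariant_ring_le n G 3 \<rho> q). f v \<noteq> 0"
      if v: "v \<in> fixed_vectors G 3 \<rho> - nullcone n G 3 \<rho>" for v
    proof -
      have "v \<in> carrier_vec 3" using v by (simp add: fixed_vectors_def)
      then obtain x y z where xyz: "v = pt x y z" using pt_exhaust by blast
      \<comment> \<open>An infinite set of values contains a nonzero \<open>a\<close>, whose action
        fixes only points with \<open>y = 0\<close>.\<close>
      obtain a where "a \<in> K - {0}" using inf unfolding K_def
        by (metis finite.emptyI finite_Diff_insert infinite_imp_nonempty all_not_in_conv Diff_empty)
      then obtain g where "g \<in> G" "a = mat_eval c g" "a \<noteq> 0" by (auto simp: K_def)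
      with v have "pt (x + a * y) y (z - a ^ q * y) = pt x y z"
        by (auto simp: fixed_vectors_def xyz \<rho>_def shear_pt)
      then have "x + a * y = x" by (metis pt_index(1))
      with \<open>a \<noteq> 0\<close> have y: "y = 0" by simp
      have "x \<noteq> 0"
      proof
        assume x: "x = 0"
        have "f v = 0" if inv_f: "f \<in> plus_part 3 (invariant_ring n G 3 \<rho>)" for f
        proof -
          obtain p where p: "p \<in> polys_in {..<3}" "f = poly_fun 3 p"
            using inv_f by (auto simp: plus_part_def invariant_ring_def coord_ring_def)
          then interpret shear_invariant p f q K
            using shear_inv[of p] inv_f by (simp add: plus_part_def)
          show ?thesis using const_z[of z] inv_f by (simp add: xyz x y plus_part_def zero_pt)
        qed
        with v show False by (auto simp: nullcone_def fixed_vectors_def)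
      qed
      then have "poly_fun 3 p0 v \<noteq> 0" using q by (simp add: xyz y f0 power_0_left)
      moreover have "poly_fun 3 p0 \<in> plus_part 3 (invariant_ring_le n G 3 \<rho> q)"
        using inv0 p0 deg0 q
        by (auto simp: plus_part_def invariant_ring_le_def coord_ring_le_def zero_pt f0)
      ultimately show ?thesis by blast
    qed
    then show "delta_set n G 3 \<rho> (invariant_ring_le n G 3 \<rho> q)"
      by (auto simp: delta_set_def invariant_ring_le_def)
  next
    fix d assume d: "delta_set n G 3 \<rho> (invariant_ring_le n G 3 \<rho> d)"
    show "q \<le> d"
    proof (rule ccontr)
      assume "\<not> q \<le> d"
      have "pt 1 0 0 \<in> fixed_vectors G 3 \<rho>"
        by (simp add: fixed_vectors_def \<rho>_def shear_pt)
      moreover have "pt 1 0 0 \<notin> nullcone n G 3 \<rho>" by (rule null0) (simp add: f0)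
      ultimately obtain f where inv_f: "f \<in> plus_part 3 (invariant_ring_le n G 3 \<rho> d)" "f (pt 1 0 0) \<noteq> 0"
        using d by (auto simp: delta_set_def)
      then obtain p where deg: "p \<in> polys_in {..<3}" "f = poly_fun 3 p" "total_degree p \<le> d"
        by (auto simp: plus_part_def invariant_ring_le_def coord_ring_le_def)
      then interpret shear_invariant p f q K
        using shear_inv[of p] inv_f by (simp add: plus_part_def invariant_ring_le_def)
      show False using const_x deg(3) \<open>\<not> q \<le> d\<close> inv_f by (simp add: plus_part_def zero_pt)
    qed
  qed
qed

theorem corollary3p7:
  fixes n :: nat and G :: "'k::alg_closed_field mat set"
  assumes "CHAR('k) > 0"
    and "linear_algebraic_group n G"
    and "infinite G"
    and "connected_group n G"
    and "unipotent_group n G"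
  shows "delta n G = \<infinity>"
proof -
  have G: "subgroup G (GL TYPE('k) n)" using assms by (simp add: linear_algebraic_group_def)
  obtain c g0 where c: "c \<in> mat_polys n" and g0: "g0 \<in> G" "mat_eval c g0 \<noteq> 0"
    and hom: "\<And>g h. g \<in> G \<Longrightarrow> h \<in> G \<Longrightarrow> mat_eval c (g * h) = mat_eval c g + mat_eval c h"
    using unipotent_group_additive_character[OF G assms(3,5)] by blast
  have one: "1\<^sub>m n \<in> G" using subgroup.one_closed[OF G] by (simp add: GL_simps)
  \<comment> \<open>\<open>c\<close> vanishes at the identity but not at \<open>g0\<close>, so it is
    not constant on \<open>G\<close> and connectedness applies.\<close>
  then have "mat_eval c (1\<^sub>m n) = 0"
    using hom[OF one one] by (metis add_cancel_right_right left_mult_one_mat one_carrier_mat)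
  then have inf: "infinite ((\<lambda>g. mat_eval c g) ` G)"
    using connected_group_infinite_image[OF G assms(4) c g0(1) one] g0(2) by simp
  have prime: "prime CHAR('k)" using assms(1) by (rule prime_CHAR_semidom)
  have "enat e \<le> delta n G" for e
  proof -
    \<comment> \<open>The exponent \<open>Suc e\<close> ensures \<open>q \<ge> 2\<close> even for
      \<open>e = 0\<close>, as the shear module requires.\<close>
    define q where "q = CHAR('k) ^ Suc e"
    have "CHAR('k) \<ge> 2" using prime by (rule prime_ge_2_nat)
    then have "2 ^ Suc e \<le> q" unfolding q_def by (intro power_mono) auto
    moreover have "Suc e < 2 ^ Suc e" by (rule less_exp)
    moreover have "(2::nat) \<le> 2 ^ Suc e" by simp
    ultimately have q: "e \<le> q" "q \<ge> 2" by linarith+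
    have frob: "(a + b) ^ q = a ^ q + b ^ q" for a b :: 'k
      using freshmans_dream'[OF prime, of q "Suc e" a b] by (simp add: q_def)
    have "enat q \<le> delta n G"
      unfolding delta_def using delta_module_shear[OF G c hom inf q(2) frob]
      by (intro Sup_upper) (auto intro!: exI[of _ 3] exI[of _ "\<lambda>g. shear q (mat_eval c g)"])
    then show ?thesis using q(1) by (meson enat_ord_simps(1) order_trans)
  qed
  then show ?thesis by (metis Suc_n_not_le_n enat_ord_simps(1) not_infinity_eq)
qed

end
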